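(* Let $G:[0,1]\to[0,1)$ be an increasing function with $G(0)=0$ which satisfies $$\liminf_{x\to0^+} x\log(1/G(x))>0 .$$ Let $w\in L^1(m)$ be a non-negative Borel measurable function on $\mathbb{T}$ such that $\int_I\log w\,dm=-\infty$ for every interval (arc) $I$ of $\mathbb{T}$. Let $\mu$ be the measure on $\overline{\mathbb{D}}$ given by $d\mu=d\mu_{\mathbb{D}}+d\mu_{\mathbb{T}}=G(1-|z|)\,dA(z)+w\,dm$. Then, for every finite $t>0$, $$\mathcal{P}^t(\mu)=\mathcal{P}^t(\mu_{\mathbb{D}})\oplus L^t(\mu_{\mathbb{T}}).$$
   Context: $\mathbb{D}=\{z\in\mathbb{C}:|z|<1\}$, $\overline{\mathbb{D}}$ is the closed unit disk, $\mathbb{T}=\{|z|=1\}$. $m$ is arclength measure on $\mathbb{T}$ normalized by $m(\mathbb{T})=1$, and $dA=\pi^{-1}dx\,dy$ is normalized area measure on $\mathbb{D}$. Intervals of $\mathbb{T}$ are arcs of positive length. The convention is $\log(1/0)=+\infty$. For a finite positive compactly supported Borel measure $\nu$ in the plane and $0<t<\infty$, $\mathcal{P}^t(\nu)$ is the closure in $L^t(\nu)$ of the analytic polynomials $p(z)=\sum_{n=0}^N p_nz^n$. $\mu_{\mathbb{D}}$ and $\mu_{\mathbb{T}}$ are the restrictions of $\mu$ to $\mathbb{D}$ and $\mathbb{T}$; $L^t(\mu_{\mathbb{D}})$ and $L^t(\mu_{\mathbb{T}})$ are regarded as closed subspaces of $L^t(\mu)$ by extending functions by zero, and $\mathcal{P}^t(\mu_{\mathbb{D}})\oplus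 L^t(\mu_{\mathbb{T}})$ is the corresponding direct sum inside $L^t(\mu)$. *)

theory Defs
  imports "HOL-Analysis.Analysis" "HOL-Computational_Algebra.Polynomial"
begin

section \<open>Extended logarithm and extended integral\<close>

text \<open>The library has \<open>ln 0 = 0\<close> and \<open>1 / 0 = 0\<close> on the reals. On \<open>ennreal\<close> we have
  \<open>1 / 0 = \<infinity>\<close>, so that \<open>eln (1 / 0) = \<infinity>\<close> and \<open>eln 0 = - \<infinity>\<close>.\<close>

definition eln :: "ennreal \<Rightarrow> ereal" where
  "eln x = (if x = 0 then - \<infinity> else if x = \<infinity> then \<infinity> else ereal (ln (enn2real x)))"

text \<open>Integral of the positive part minus integral of the negative part (\<open>e2ennreal\<close> truncates
  negative values to \<open>0\<close>). Since \<open>\<infinity> - \<infinity> = \<infinity>\<close> on \<open>ereal\<close>, the value \<open>- \<infinity>\<close> is attained only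
  when the positive part is integrable and the negative part is not.\<close>

definition ext_integral :: "'a measure \<Rightarrow> ('a \<Rightarrow> ereal) \<Rightarrow> ereal" where
  "ext_integral M f =
     enn2ereal (\<integral>\<^sup>+x. e2ennreal (f x) \<partial>M) - enn2ereal (\<integral>\<^sup>+x. e2ennreal (- f x) \<partial>M)"

definition ext_set_integral :: "'a measure \<Rightarrow> 'a set \<Rightarrow> ('a \<Rightarrow> ereal) \<Rightarrow> ereal" where
  "ext_set_integral M A f = ext_integral M (\<lambda>x. if x \<in> A then f x else 0)"


section \<open>Measures in the plane\<close>

definition circle_measure :: "complex measure" where
  "circle_measure = distr (uniform_measure lborel {0..<2 * pi}) borel cis"

definition area_measure :: "complex measure" where
  "area_measure = scale_measure (ennreal (1 / pi)) lborel"

text \<open>Arcs of positive length, with or without their endpoints; the full circle and the circle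
  without one point are included.\<close>

definition circle_arc :: "complex set \<Rightarrow> bool" where
  "circle_arc I \<longleftrightarrow> (\<exists>a b J. a < b \<and> b \<le> a + 2 * pi \<and>
     {a<..<b} \<subseteq> J \<and> J \<subseteq> {a..b} \<and> I = cis ` J)"

text \<open>Intended for \<open>sets M = sets N\<close>.\<close>

definition add_measure :: "'a measure \<Rightarrow> 'a measure \<Rightarrow> 'a measure" where
  "add_measure M N = measure_of (space M) (sets M) (\<lambda>A. emeasure M A + emeasure N A)"

lemma space_add_measure [simp]: "space (add_measure M N) = space M"
  and sets_add_measure [simp, measurable_cong]: "sets (add_measure M N) = sets M"
  by (simp_all add: add_measure_def)

lemma emeasure_add_measure:
  assumes "sets M = sets N" and "A \<in> sets M"
  shows "emeasure (add_measure M N) A = emeasure M A + emeasure N A"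
proof (rule emeasure_measure_of[OF add_measure_def sets.space_closed])
  show "positive (sets (add_measure M N)) (\<lambda>A. emeasure M A + emeasure N A)"
    by (simp add: positive_def)
  show "countably_additive (sets (add_measure M N)) (\<lambda>A. emeasure M A + emeasure N A)"
  proof (rule countably_additiveI)
    fix B :: "nat \<Rightarrow> 'a set"
    assume B: "range B \<subseteq> sets (add_measure M N)" "disjoint_family B"
    show "(\<Sum>i. emeasure M (B i) + emeasure N (B i)) =
        emeasure M (\<Union> (range B)) + emeasure N (\<Union> (range B))"
      using B assms(1) by (subst suminf_add[symmetric]) (auto simp: suminf_emeasure)
  qed
  show "A \<in> sets (add_measure M N)"
    using assms(2) by simp
qed

definition disk_part :: "(real \<Rightarrow> real) \<Rightarrow> complex measure" where
  "disk_part G = density area_measure (\<lambda>z. ennreal (indicator (ball 0 1) z * G (1 - cmod z)))"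

definition circle_part :: "(complex \<Rightarrow> real) \<Rightarrow> complex measure" where
  "circle_part w = density circle_measure (\<lambda>z. ennreal (indicator (sphere 0 1) z * w z))"


section \<open>The spaces \<open>L\<^sup>t\<close> and \<open>P\<^sup>t\<close>, for \<open>0 < t < \<infinity>\<close>\<close>

text \<open>Elements are represented by measurable functions; all the sets of functions below are closed
  under modification on null sets, so that equality of such sets is equality of the corresponding
  sets of equivalence classes.\<close>

definition Lt :: "real \<Rightarrow> 'a measure \<Rightarrow> ('a \<Rightarrow> complex) set" where
  "Lt t M = {f \<in> borel_measurable M. integrable M (\<lambda>x. cmod (f x) powr t)}"

text \<open>Only a quasi-norm for \<open>t < 1\<close>, but it induces the same topology as the usual metric
  \<open>\<integral> \<bar>f - g\<bar>\<^sup>t\<close>.\<close>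

definition Lt_norm :: "real \<Rightarrow> 'a measure \<Rightarrow> ('a \<Rightarrow> complex) \<Rightarrow> real" where
  "Lt_norm t M f = (\<integral>x. cmod (f x) powr t \<partial>M) powr (1 / t)"

definition Lt_closure :: "real \<Rightarrow> 'a measure \<Rightarrow> ('a \<Rightarrow> complex) set \<Rightarrow> ('a \<Rightarrow> complex) set" where
  "Lt_closure t M S =
     {f \<in> Lt t M. \<forall>e>0. \<exists>g \<in> S \<inter> Lt t M. Lt_norm t M (\<lambda>x. f x - g x) < e}"

text \<open>Every polynomial lies in \<open>Lt t M\<close> when \<open>M\<close> is finite and compactly supported.\<close>

definition Pt :: "real \<Rightarrow> complex measure \<Rightarrow> (complex \<Rightarrow> complex) set" where
  "Pt t M = Lt_closure t M (range poly)"

text \<open>The image in \<open>Lt t M\<close> of a set \<open>F\<close> of functions under restriction to \<open>S\<close> followed by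
  extension by zero.\<close>

definition extend_zero ::
  "real \<Rightarrow> 'a measure \<Rightarrow> 'a set \<Rightarrow> ('a \<Rightarrow> complex) set \<Rightarrow> ('a \<Rightarrow> complex) set" where
  "extend_zero t M S F =
     {f \<in> Lt t M. \<exists>g\<in>F. AE x in M. f x = (if x \<in> S then g x else 0)}"

definition Lt_direct_sum ::
  "real \<Rightarrow> 'a measure \<Rightarrow> ('a \<Rightarrow> complex) set \<Rightarrow> ('a \<Rightarrow> complex) set \<Rightarrow> ('a \<Rightarrow> complex) set \<Rightarrow> bool" where
  "Lt_direct_sum t M E A B \<longleftrightarrow>
     E = {f \<in> Lt t M. \<exists>g\<in>A. \<exists>h\<in>B. AE x in M. f x = g x + h x} \<and>
     A \<inter> B = {f \<in> Lt t M. AE x in M. f x = 0}"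

end

theory Submission
  imports Defs "HOL-Complex_Analysis.Complex_Analysis"
begin

text \<open>
  Write \<open>\<mu>\<^sub>D\<close> and \<open>\<mu>\<^sub>T\<close> for the parts of the measure on the disk and on the circle. Everything
  follows from the existence of polynomials \<open>F\<close> with \<open>F(0) = 1\<close> which are close to \<open>1\<close> in
  \<open>L\<^sup>t(\<mu>\<^sub>D)\<close> and close to \<open>0\<close> in \<open>L\<^sup>t(\<mu>\<^sub>T)\<close> (lemma \<open>separating_polynomial\<close>). Indeed, \<open>p (1 - F)\<close>
  then approximates \<open>0\<close> on the disk and \<open>p\<close> on the circle, for every polynomial \<open>p\<close>. Moreover
  \<open>1 - F\<close> is divisible by \<open>z\<close>, and \<open>(1 - F) / z\<close> approximates \<open>cnj z\<close> on the circle, so that the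
  polynomials are dense in \<open>L\<^sup>t(\<mu>\<^sub>T)\<close>. Hence the values on the disk and on the circle can be
  prescribed independently, and \<open>P\<^sup>t(\<mu>)\<close> consists of all functions of \<open>L\<^sup>t(\<mu>)\<close> whose restriction
  to the disk is in \<open>P\<^sup>t(\<mu>\<^sub>D)\<close>.

  The polynomials \<open>F\<close> are partial sums of \<open>exp q\<close>, where \<open>q\<close> is a polynomial with \<open>q(0) = 0\<close>. On the
  circle \<open>\<bar>exp q\<bar>\<^sup>t w = exp (t Re q) w\<close>, so the real part of \<open>q\<close> has to be very negative where \<open>w\<close>
  is not small, while \<open>q\<close> itself has to be close to \<open>0\<close> in the disk. Both are reconciled by
  oscillation. Cut the circle into short arcs of length \<open>h\<close>, and on each arc let \<open>\<phi>\<close> be the constant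
  \<open>- M\<close> plus a positive multiple of a truncation of \<open>log (1 / w)\<close>, the multiple being chosen such that
  \<open>\<phi>\<close> has mean zero on the arc. Since \<open>log w\<close> has integral \<open>- \<infinity>\<close> over every arc, a multiple of size
  at most \<open>1 / t\<close> suffices if the truncation is high enough, and then
  \<open>exp (t \<phi>) w \<le> exp (- t M) (1 + w)\<close> pointwise. The primitive of \<open>\<phi>\<close> is at most \<open>2 M h\<close>, however,
  and \<open>h\<close> may be chosen small depending on \<open>M\<close> (lemma \<open>exists_boundary_function\<close>).

  Let \<open>Re q\<close> approximate \<open>\<phi>\<close> in \<open>L\<^sup>1\<close> with respect to \<open>1 + w\<close>. Integration by parts in the formula
  which recovers \<open>q\<close> from \<open>Re q\<close> moves a derivative to the kernel, and the derivative of the kernel has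
  the Poisson kernel as modulus, up to normalization. This yields \<open>\<bar>q(z)\<bar> \<le> 2 \<delta> / (1 - \<bar>z\<bar>)\<close>, where
  \<open>\<delta>\<close> bounds the primitive of \<open>Re q\<close> (lemma \<open>poly_bound_by_primitive_of_Re\<close>). With \<open>\<delta>\<close> tending to
  \<open>0\<close>, the functions \<open>exp q\<close> tend to \<open>1\<close> in the disk, and the bound \<open>exp (2 t \<delta> / (1 - \<bar>z\<bar>))\<close> for
  \<open>\<bar>exp q\<bar>\<^sup>t\<close> is absorbed by \<open>G(1 - \<bar>z\<bar>) \<le> exp (- c / (1 - \<bar>z\<bar>))\<close>, which is what the condition on
  the decay of \<open>G\<close> says. Dominated convergence finishes the proof.
\<close>

section \<open>Approximation by polynomials in \<open>L\<^sup>t\<close>\<close>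

text \<open>The \<open>t\<close>-th power of \<open>Lt_norm\<close> of a difference, as a nonnegative integral, so that it needs no
  integrability and splits over sums of measures. It satisfies the triangle inequality only up to the
  factor \<open>2 powr t\<close>, which is harmless for questions of approximation and treats all \<open>t > 0\<close> alike.\<close>

definition Lt_dist :: "real \<Rightarrow> 'a measure \<Rightarrow> ('a \<Rightarrow> complex) \<Rightarrow> ('a \<Rightarrow> complex) \<Rightarrow> ennreal" where
  "Lt_dist t M f g = (\<integral>\<^sup>+x. ennreal (cmod (f x - g x) powr t) \<partial>M)"

definition poly_approximable :: "real \<Rightarrow> complex measure \<Rightarrow> (complex \<Rightarrow> complex) \<Rightarrow> bool" where
  "poly_approximable t M f \<longleftrightarrow> (\<forall>e>0. \<exists>p. Lt_dist t M f (poly p) < ennreal e)"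

lemma powr_norm_diff_le:
  fixes a b c :: "'a::real_normed_vector"
  assumes "0 < t"
  shows "norm (a - c) powr t \<le> 2 powr t * (norm (a - b) powr t + norm (b - c) powr t)"
proof -
  have "norm (a - c) \<le> 2 * max (norm (a - b)) (norm (b - c))"
    using norm_triangle_ineq[of "a - b" "b - c"] by simp
  then have "norm (a - c) powr t \<le> (2 * max (norm (a - b)) (norm (b - c))) powr t"
    using assms by (intro powr_mono2) auto
  also have "\<dots> = 2 powr t * max (norm (a - b)) (norm (b - c)) powr t"
    by (simp add: powr_mult)
  also have "\<dots> \<le> 2 powr t * (norm (a - b) powr t + norm (b - c) powr t)"
    by (intro mult_left_mono) (auto simp: max_def)
  finally show ?thesis .
qed

lemma borel_measurable_poly [measurable]: "poly (p :: complex poly) \<in> borel_measurable borel"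
  by (intro borel_measurable_continuous_onI continuous_intros)

lemma Lt_dist_commute: "Lt_dist t M f g = Lt_dist t M g f"
  by (simp add: Lt_dist_def norm_minus_commute)

lemma Lt_dist_triangle:
  assumes t: "0 < t" and [measurable]: "f \<in> borel_measurable M" "g \<in> borel_measurable M"
    "h \<in> borel_measurable M"
  shows "Lt_dist t M f h \<le> ennreal (2 powr t) * (Lt_dist t M f g + Lt_dist t M g h)"
proof -
  have "Lt_dist t M f h \<le> (\<integral>\<^sup>+x. ennreal (2 powr t) *
      (ennreal (cmod (f x - g x) powr t) + ennreal (cmod (g x - h x) powr t)) \<partial>M)"
    unfolding Lt_dist_def
    by (intro nn_integral_mono)
      (simp flip: ennreal_plus ennreal_mult add: ennreal_leI powr_norm_diff_le[OF t])
  also have "\<dots> = ennreal (2 powr t) * (Lt_dist t M f g + Lt_dist t M g h)"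
    unfolding Lt_dist_def by (subst nn_integral_cmult) (auto simp: nn_integral_add)
  finally show ?thesis .
qed

lemma Lt_dist_triangle_less:
  assumes t: "0 < t" and meas: "f \<in> borel_measurable M" "g \<in> borel_measurable M"
      "h \<in> borel_measurable M"
    and fg: "Lt_dist t M f g < ennreal (e / (2 * 2 powr t))"
    and gh: "Lt_dist t M g h < ennreal (e / (2 * 2 powr t))"
  shows "Lt_dist t M f h < ennreal e"
proof -
  have e: "0 < e"
  proof (rule ccontr)
    assume "\<not> 0 < e"
    then have "e / (2 * 2 powr t) \<le> 0"
      by (simp add: divide_nonpos_pos)
    with fg show False
      by (simp add: ennreal_neg)
  qed
  have "Lt_dist t M f h \<le> ennreal (2 powr t) * (Lt_dist t M f g + Lt_dist t M g h)"
    by (rule Lt_dist_triangle[OF t meas])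
  also have "\<dots> < ennreal (2 powr t) *
      (ennreal (e / (2 * 2 powr t)) + ennreal (e / (2 * 2 powr t)))"
    using fg gh by (intro ennreal_mult_strict_left_mono add_strict_mono)
      (auto simp: less_top[symmetric])
  also have "\<dots> = ennreal (2 powr t * (e / (2 * 2 powr t) + e / (2 * 2 powr t)))"
    using e by (simp flip: ennreal_plus ennreal_mult)
  also have "2 powr t * (e / (2 * 2 powr t) + e / (2 * 2 powr t)) = e"
    by (simp add: field_simps)
  finally show ?thesis .
qed

lemma Lt_dist_le_mult:
  assumes "f \<in> borel_measurable M" "g \<in> borel_measurable M"
    and t: "0 < t" and C: "0 \<le> C" and le: "AE x in M. cmod (f' x - g' x) \<le> C * cmod (f x - g x)"
  shows "Lt_dist t M f' g' \<le> ennreal (C powr t) * Lt_dist t M f g"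
proof -
  have [measurable]: "f \<in> borel_measurable M" "g \<in> borel_measurable M"
    by fact+
  have "Lt_dist t M f' g' \<le> (\<integral>\<^sup>+x. ennreal (C powr t) * ennreal (cmod (f x - g x) powr t) \<partial>M)"
    unfolding Lt_dist_def
    using le C t
    by (intro nn_integral_mono_AE)
      (auto intro!: ennreal_leI powr_mono2 simp flip: ennreal_mult powr_mult elim!: eventually_mono)
  also have "\<dots> = ennreal (C powr t) * Lt_dist t M f g"
    unfolding Lt_dist_def by (subst nn_integral_cmult) auto
  finally show ?thesis .
qed

lemma Lt_dist_less_if_le_mult:
  assumes "f \<in> borel_measurable M" "g \<in> borel_measurable M"
    and t: "0 < t" and C: "0 < C" and le: "AE x in M. cmod (f' x - g' x) \<le> C * cmod (f x - g x)"
    and less: "Lt_dist t M f g < ennreal (e / C powr t)"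
  shows "Lt_dist t M f' g' < ennreal e"
proof -
  have "Lt_dist t M f' g' \<le> ennreal (C powr t) * Lt_dist t M f g"
    using assms by (intro Lt_dist_le_mult) auto
  also have "\<dots> < ennreal (C powr t) * ennreal (e / C powr t)"
    using less C by (intro ennreal_mult_strict_left_mono) auto
  also have "\<dots> = ennreal e"
    using C by (simp flip: ennreal_mult' )
  finally show ?thesis .
qed

lemma Lt_dist_cong_AE:
  assumes "AE x in M. f x - g x = f' x - g' x"
  shows "Lt_dist t M f g = Lt_dist t M f' g'"
  unfolding Lt_dist_def using assms by (intro nn_integral_cong_AE) (auto elim!: eventually_mono)

lemma mem_Lt_iff:
  "f \<in> Lt t M \<longleftrightarrow> f \<in> borel_measurable M \<and> Lt_dist t M f (\<lambda>_. 0) < \<infinity>"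
  unfolding Lt_def Lt_dist_def by (auto simp: integrable_iff_bounded)

lemma Lt_dist_finite:
  assumes t: "0 < t" and f: "f \<in> Lt t M" and g: "g \<in> Lt t M"
  shows "Lt_dist t M f g < \<infinity>"
proof -
  have "Lt_dist t M f g \<le>
      ennreal (2 powr t) * (Lt_dist t M f (\<lambda>_. 0) + Lt_dist t M (\<lambda>_. 0) g)"
    using f g by (intro Lt_dist_triangle t) (auto simp: mem_Lt_iff)
  also have "\<dots> < \<infinity>"
    using f g by (simp add: mem_Lt_iff ennreal_mult_less_top Lt_dist_commute[of t M "\<lambda>_. 0"])
  finally show ?thesis .
qed

lemma Lt_norm_less_iff:
  assumes t: "0 < t" and f: "f \<in> Lt t M" and g: "g \<in> Lt t M" and e: "0 < e"
  shows "Lt_norm t M (\<lambda>x. f x - g x) < e \<longleftrightarrow> Lt_dist t M f g < ennreal (e powr t)"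
proof -
  have [measurable]: "f \<in> borel_measurable M" "g \<in> borel_measurable M"
    using f g by (auto simp: Lt_def)
  have int: "integrable M (\<lambda>x. cmod (f x - g x) powr t)"
    using Lt_dist_finite[OF t f g] by (auto simp: Lt_dist_def integrable_iff_bounded)
  define I where "I = (\<integral>x. cmod (f x - g x) powr t \<partial>M)"
  have I: "0 \<le> I"
    unfolding I_def by simp
  have D: "Lt_dist t M f g = ennreal I"
    unfolding I_def Lt_dist_def by (rule nn_integral_eq_integral[OF int]) simp
  have "I powr (1 / t) < e \<longleftrightarrow> I < e powr t"
  proof
    assume "I powr (1 / t) < e"
    then have "(I powr (1 / t)) powr t < e powr t"
      using t by (intro powr_less_mono2) auto
    then show "I < e powr t"
      using t I by (simp add: powr_powr)
  next
    assume "I < e powr t"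
    then have "I powr (1 / t) < (e powr t) powr (1 / t)"
      using t I by (intro powr_less_mono2) auto
    then show "I powr (1 / t) < e"
      using t e by (simp add: powr_powr)
  qed
  then show ?thesis
    unfolding D Lt_norm_def I_def[symmetric] using I by (simp add: ennreal_less_iff)
qed

text \<open>The measures for which every polynomial is in \<open>Lt t M\<close>, so that \<open>Pt t M\<close> consists of the
  \<open>poly_approximable\<close> functions of \<open>Lt t M\<close>.\<close>

locale closed_disk_measure = finite_measure M for M :: "complex measure" +
  assumes sets_eq_borel [measurable_cong]: "sets M = sets borel"
    and AE_closed_disk: "AE z in M. cmod z \<le> 1"
begin

lemma continuous_mem_Lt:
  assumes t: "0 < t" and f: "continuous_on UNIV f"
  shows "f \<in> Lt t M"
proof -
  have "f ` cball 0 1 \<noteq> {}" and "compact (f ` cball 0 1)"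
    using f by (auto intro!: compact_continuous_image intro: continuous_on_subset)
  then obtain C where "\<forall>z\<in>f ` cball 0 1. cmod z \<le> C"
    using compact_imp_bounded[of "f ` cball 0 1"] by (auto simp: bounded_iff)
  then have C: "\<And>z. cmod z \<le> 1 \<Longrightarrow> cmod (f z) \<le> C"
    by simp
  have [measurable]: "f \<in> borel_measurable borel"
    using f by (rule borel_measurable_continuous_onI)
  have "integrable M (\<lambda>x. cmod (f x) powr t)"
    using AE_closed_disk t
    by (intro integrable_const_bound[of _ "C powr t"])
      (auto intro!: powr_mono2 C elim!: eventually_mono)
  then show ?thesis
    by (simp add: Lt_def)
qed

lemma poly_mem_Lt: "0 < t \<Longrightarrow> poly p \<in> Lt t M"
  by (intro continuous_mem_Lt continuous_intros)

lemma mem_Pt_iff: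
  assumes t: "0 < t"
  shows "f \<in> Pt t M \<longleftrightarrow> f \<in> Lt t M \<and> poly_approximable t M f"
proof -
  have "(\<forall>e>0. \<exists>g\<in>range poly \<inter> Lt t M. Lt_norm t M (\<lambda>x. f x - g x) < e) \<longleftrightarrow>
      poly_approximable t M f" (is "?L \<longleftrightarrow> ?R") if f: "f \<in> Lt t M"
  proof
    assume L: ?L
    show ?R
      unfolding poly_approximable_def
    proof (intro allI impI)
      fix e :: real assume e: "0 < e"
      from L[rule_format, of "e powr (1 / t)"] e
      obtain p where p: "Lt_norm t M (\<lambda>x. f x - poly p x) < e powr (1 / t)"
        by auto
      show "\<exists>p. Lt_dist t M f (poly p) < ennreal e"
        using Lt_norm_less_iff[OF t f poly_mem_Lt[OF t], of "e powr (1 / t)" p] p e t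
        by (auto simp: powr_powr)
    qed
  next
    assume R: ?R
    show ?L
    proof (intro allI impI)
      fix e :: real assume e: "0 < e"
      with R obtain p where "Lt_dist t M f (poly p) < ennreal (e powr t)"
        by (fastforce simp: poly_approximable_def)
      then show "\<exists>g\<in>range poly \<inter> Lt t M. Lt_norm t M (\<lambda>x. f x - g x) < e"
        using Lt_norm_less_iff[OF t f poly_mem_Lt[OF t] e] poly_mem_Lt[OF t] by auto
    qed
  qed
  then show ?thesis
    by (auto simp: Pt_def Lt_closure_def)
qed

lemma poly_approximable_limit:
  assumes t: "0 < t" and f: "f \<in> borel_measurable borel"
    and lim: "\<And>e. 0 < e \<Longrightarrow>
      \<exists>g \<in> borel_measurable borel. poly_approximable t M g \<and> Lt_dist t M f g < ennreal e"
  shows "poly_approximable t M f"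
  unfolding poly_approximable_def
proof (intro allI impI)
  fix e :: real assume "0 < e"
  then have e: "0 < e / (2 * 2 powr t)"
    by simp
  from lim[OF e] obtain g where g: "g \<in> borel_measurable borel" "poly_approximable t M g"
      "Lt_dist t M f g < ennreal (e / (2 * 2 powr t))"
    by auto
  from g(2) e obtain p where p: "Lt_dist t M g (poly p) < ennreal (e / (2 * 2 powr t))"
    unfolding poly_approximable_def by blast
  have "Lt_dist t M f (poly p) < ennreal e"
    by (rule Lt_dist_triangle_less[OF t _ _ _ g(3) p]) (use f g(1) in measurable)
  then show "\<exists>p. Lt_dist t M f (poly p) < ennreal e" ..
qed

lemma poly_approximable_add:
  assumes t: "0 < t" and [measurable]: "f \<in> borel_measurable borel" "g \<in> borel_measurable borel"
    and f: "poly_approximable t M f" and g: "poly_approximable t M g"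
  shows "poly_approximable t M (\<lambda>x. f x + g x)"
  unfolding poly_approximable_def
proof (intro allI impI)
  fix e :: real assume "0 < e"
  then have e: "0 < e / (2 * 2 powr t)"
    by simp
  from f e obtain p where p: "Lt_dist t M f (poly p) < ennreal (e / (2 * 2 powr t))"
    unfolding poly_approximable_def by blast
  from g e obtain q where q: "Lt_dist t M g (poly q) < ennreal (e / (2 * 2 powr t))"
    unfolding poly_approximable_def by blast
  have "Lt_dist t M (\<lambda>x. f x + g x) (poly (p + q)) < ennreal e"
  proof (rule Lt_dist_triangle_less[OF t])
    show "Lt_dist t M (\<lambda>x. f x + g x) (\<lambda>x. poly p x + g x) < ennreal (e / (2 * 2 powr t))"
      using p by (subst Lt_dist_cong_AE[where f' = f and g' = "poly p"]) auto
    show "Lt_dist t M (\<lambda>x. poly p x + g x) (poly (p + q)) < ennreal (e / (2 * 2 powr t))"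
      using q by (subst Lt_dist_cong_AE[where f' = g and g' = "poly q"]) auto
  qed measurable
  then show "\<exists>p. Lt_dist t M (\<lambda>x. f x + g x) (poly p) < ennreal e" ..
qed

lemma poly_approximable_poly: "poly_approximable t M (poly p)"
  unfolding poly_approximable_def Lt_dist_def
  by (auto intro!: exI[of _ p])

lemma poly_approximable_mult_poly:
  assumes t: "0 < t" and [measurable]: "f \<in> borel_measurable borel"
    and f: "poly_approximable t M f"
  shows "poly_approximable t M (\<lambda>x. poly q x * f x)"
  unfolding poly_approximable_def
proof (intro allI impI)
  fix e :: real assume e: "0 < e"
  have "compact (poly q ` cball 0 1)"
    by (intro compact_continuous_image continuous_intros) auto
  then obtain C where C: "0 < C" "\<And>z. cmod z \<le> 1 \<Longrightarrow> cmod (poly q z) \<le> C"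
    using compact_imp_bounded[of "poly q ` cball 0 1"] by (auto simp: bounded_pos)
  have "0 < e / C powr t"
    using e C by simp
  with f obtain p where p: "Lt_dist t M f (poly p) < ennreal (e / C powr t)"
    unfolding poly_approximable_def by blast
  have "Lt_dist t M (\<lambda>x. poly q x * f x) (poly (q * p)) < ennreal e"
  proof (rule Lt_dist_less_if_le_mult[OF _ _ t C(1) _ p])
    show "AE x in M. cmod (poly q x * f x - poly (q * p) x) \<le> C * cmod (f x - poly p x)"
      using AE_closed_disk
    proof eventually_elim
      case (elim x)
      have "poly q x * f x - poly (q * p) x = poly q x * (f x - poly p x)"
        by (simp add: algebra_simps)
      then show ?case
        using C(2)[OF elim] by (simp add: norm_mult mult_right_mono)
    qed
  qed measurable
  then show "\<exists>p. Lt_dist t M (\<lambda>x. poly q x * f x) (poly p) < ennreal e" ..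
qed

end

lemma nn_integral_add_measure:
  assumes MN: "sets M = sets N" and f: "f \<in> borel_measurable M"
  shows "(\<integral>\<^sup>+x. f x \<partial>add_measure M N) = (\<integral>\<^sup>+x. f x \<partial>M) + (\<integral>\<^sup>+x. f x \<partial>N)"
  using f
proof (induction rule: borel_measurable_induct)
  case (cong f g)
  have "space N = space M"
    by (rule sets_eq_imp_space_eq[OF MN, symmetric])
  then have "(\<integral>\<^sup>+x. f x \<partial>add_measure M N) = (\<integral>\<^sup>+x. g x \<partial>add_measure M N)"
    "(\<integral>\<^sup>+x. f x \<partial>M) = (\<integral>\<^sup>+x. g x \<partial>M)" "(\<integral>\<^sup>+x. f x \<partial>N) = (\<integral>\<^sup>+x. g x \<partial>N)"
    by (auto intro!: nn_integral_cong simp: cong(3))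
  then show ?case
    using cong(4) by simp
next
  case (set A)
  then show ?case
    using MN by (simp add: emeasure_add_measure)
next
  case (mult u c)
  have "u \<in> borel_measurable N" "u \<in> borel_measurable (add_measure M N)"
    using mult(2) MN by (auto cong: measurable_cong_sets)
  with mult show ?case
    by (simp add: nn_integral_cmult distrib_left)
next
  case (add u v)
  have "u \<in> borel_measurable N" "u \<in> borel_measurable (add_measure M N)"
    "v \<in> borel_measurable N" "v \<in> borel_measurable (add_measure M N)"
    using add(1,3) MN by (auto cong: measurable_cong_sets)
  with add show ?case
    by (simp add: nn_integral_add ac_simps)
next
  case (seq U)
  have m: "U i \<in> borel_measurable N" "U i \<in> borel_measurable (add_measure M N)" for i
    using seq(1) MN by (auto cong: measurable_cong_sets)
  have inc: "incseq (\<lambda>i. integral\<^sup>N K (U i))" for K :: "'a measure"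
    using seq(3) by (auto simp: incseq_def le_fun_def intro!: nn_integral_mono)
  have "(SUP i. integral\<^sup>N M (U i) + integral\<^sup>N N (U i)) =
      (SUP i. integral\<^sup>N M (U i)) + (SUP i. integral\<^sup>N N (U i))"
    by (intro ennreal_SUP_add inc)
  then show ?case
    using seq m by (simp add: nn_integral_monotone_convergence_SUP image_comp)
qed

lemma AE_add_measure_iff:
  assumes MN: "sets M = sets N" and P: "{x \<in> space M. P x} \<in> sets M"
  shows "(AE x in add_measure M N. P x) \<longleftrightarrow> (AE x in M. P x) \<and> (AE x in N. P x)"
proof -
  define B where "B = {x \<in> space M. \<not> P x}"
  have "B = space M - {x \<in> space M. P x}"
    by (auto simp: B_def)
  with P have B: "B \<in> sets M"
    by auto
  have "(AE x in K. P x) \<longleftrightarrow> emeasure K B = 0" if "sets K = sets M" for K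
  proof (rule AE_iff_measurable)
    show "B \<in> sets K"
      using B that by simp
    show "{x \<in> space K. \<not> P x} = B"
      unfolding B_def sets_eq_imp_space_eq[OF that] ..
  qed
  then show ?thesis
    using B MN by (simp add: emeasure_add_measure)
qed

section \<open>Polynomials and their boundary real parts\<close>

lemma one_minus_mult_cis_neq_0: "cmod z < 1 \<Longrightarrow> 1 - z * cis \<theta> \<noteq> 0"
proof
  assume z: "cmod z < 1" and "1 - z * cis \<theta> = 0"
  then have "cmod (z * cis \<theta>) = 1"
    by (metis eq_iff_diff_eq_0 norm_one)
  with z show False
    by (simp add: norm_mult)
qed

text \<open>Cauchy's integral formula with \<open>d\<zeta> / (\<zeta> - z) = \<i> d\<theta> / (1 - z cnj \<zeta>)\<close> for \<open>\<zeta> = cis \<theta>\<close>.\<close>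

lemma Cauchy_integral_cis:
  assumes h: "h holomorphic_on cball 0 1" and z: "cmod z < 1"
  shows "((\<lambda>\<theta>. h (cis \<theta>) / (1 - z * cis (- \<theta>))) has_integral 2 * of_real pi * h z) {0..2 * pi}"
proof -
  have "((\<lambda>u. h u / (u - z)) has_contour_integral (2 * of_real pi * \<i> * h z)) (circlepath 0 1)"
    using h z by (intro Cauchy_integral_circlepath_simple) auto
  then have "((\<lambda>\<theta>. h (cis \<theta>) / (cis \<theta> - z) * \<i> * cis \<theta>) has_integral
      2 * of_real pi * \<i> * h z) {0..2 * pi}"
    by (simp add: circlepath_def has_contour_integral_part_circlepath_iff)
  then have "((\<lambda>\<theta>. - \<i> * (h (cis \<theta>) / (cis \<theta> - z) * \<i> * cis \<theta>)) has_integral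
      - \<i> * (2 * of_real pi * \<i> * h z)) {0..2 * pi}"
    by (rule has_integral_mult_right)
  moreover have "- \<i> * (h (cis \<theta>) / (cis \<theta> - z) * \<i> * cis \<theta>) = h (cis \<theta>) / (1 - z * cis (- \<theta>))"
    for \<theta>
  proof -
    have "cis (- \<theta>) * cis \<theta> = 1"
      by (simp add: cis_mult)
    then have "cis \<theta> - z = (1 - z * cis (- \<theta>)) * cis \<theta>"
      by (simp only: left_diff_distrib mult.assoc) simp
    then have "- \<i> * (h (cis \<theta>) / (cis \<theta> - z) * \<i> * cis \<theta>) =
        - \<i> * (h (cis \<theta>) / ((1 - z * cis (- \<theta>)) * cis \<theta>) * \<i> * cis \<theta>)"
      by (simp only:)
    then show ?thesis
      by (simp add: ac_simps)
  qed
  ultimately show ?thesis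
    by (simp add: algebra_simps)
qed

lemma holomorphic_on_divide_one_minus_cnj_mult:
  assumes "cmod z < 1" and "h holomorphic_on cball 0 1"
  shows "(\<lambda>u. h u / (1 - cnj z * u)) holomorphic_on cball 0 1"
proof (intro holomorphic_intros assms)
  fix u :: complex assume "u \<in> cball 0 1"
  then have "cmod (cnj z * u) < 1"
    using assms(1) by (simp add: norm_mult) (metis mult_left_le norm_ge_zero order_le_less_trans)
  then show "1 - cnj z * u \<noteq> 0"
    by (metis eq_iff_diff_eq_0 less_irrefl norm_one)
qed

text \<open>For \<open>\<zeta> = cis \<theta>\<close> the integrand is \<open>h(\<zeta>) / (1 - z cnj \<zeta>)\<close> with the holomorphic function
  \<open>h(\<zeta>) = 1 / (1 - cnj z \<zeta>)\<close>, so this is Cauchy's formula.\<close>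

lemma Poisson_integral_one:
  assumes z: "cmod z < 1"
  shows "((\<lambda>\<theta>. 1 / (cmod (1 - z * cis (- \<theta>)))\<^sup>2) has_integral 2 * pi / (1 - (cmod z)\<^sup>2)) {0..2 * pi}"
proof -
  have "((\<lambda>\<theta>. 1 / (1 - cnj z * cis \<theta>) / (1 - z * cis (- \<theta>))) has_integral
      2 * of_real pi * (1 / (1 - cnj z * z))) {0..2 * pi}"
    by (intro Cauchy_integral_cis holomorphic_on_divide_one_minus_cnj_mult holomorphic_intros z)
  moreover have "1 / (1 - cnj z * cis \<theta>) / (1 - z * cis (- \<theta>)) =
      of_real (1 / (cmod (1 - z * cis (- \<theta>)))\<^sup>2)" for \<theta>
  proof -
    have "1 - cnj z * cis \<theta> = cnj (1 - z * cis (- \<theta>))"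
      by (simp add: cis_cnj)
    then have "1 / (1 - cnj z * cis \<theta>) / (1 - z * cis (- \<theta>)) =
        1 / ((1 - z * cis (- \<theta>)) * cnj (1 - z * cis (- \<theta>)))"
      by (simp add: mult.commute)
    then show ?thesis
      by (simp only: complex_norm_square[symmetric] of_real_divide of_real_1)
  qed
  moreover have "2 * of_real pi * (1 / (1 - cnj z * z)) = of_real (2 * pi / (1 - (cmod z)\<^sup>2))"
    using complex_norm_square[of z] by (simp add: mult.commute)
  ultimately have "((\<lambda>\<theta>. complex_of_real (1 / (cmod (1 - z * cis (- \<theta>)))\<^sup>2)) has_integral
      of_real (2 * pi / (1 - (cmod z)\<^sup>2))) {0..2 * pi}"
    by simp
  from has_integral_linear[OF this bounded_linear_Re] show ?thesis
    by (simp only: o_def Re_complex_of_real)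
qed

text \<open>In \<open>2 Re q = q + cnj q\<close> the first summand contributes \<open>q(z)\<close> by Cauchy's formula. The second one
  contributes the conjugate of the mean value of a holomorphic function that vanishes at \<open>0\<close>.\<close>

lemma poly_eq_integral_Re:
  assumes z: "cmod z < 1" and q: "poly q 0 = 0"
  shows "((\<lambda>\<theta>. of_real (Re (poly q (cis \<theta>))) / (1 - z * cis (- \<theta>))) has_integral
    of_real pi * poly q z) {0..2 * pi}"
proof -
  have 1: "((\<lambda>\<theta>. poly q (cis \<theta>) / (1 - z * cis (- \<theta>))) has_integral
      2 * of_real pi * poly q z) {0..2 * pi}"
    by (intro Cauchy_integral_cis holomorphic_intros z)
  have "((\<lambda>\<theta>. poly q (cis \<theta>) / (1 - cnj z * cis \<theta>) / (1 - 0 * cis (- \<theta>))) has_integral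
      2 * of_real pi * (poly q 0 / (1 - cnj z * 0))) {0..2 * pi}"
    by (intro Cauchy_integral_cis holomorphic_on_divide_one_minus_cnj_mult holomorphic_intros z) auto
  then have "((\<lambda>\<theta>. cnj (poly q (cis \<theta>) / (1 - cnj z * cis \<theta>))) has_integral 0) {0..2 * pi}"
    using q by (subst has_integral_cnj[where I = 0, unfolded o_def, simplified]) simp
  then have I: "((\<lambda>\<theta>. (poly q (cis \<theta>) / (1 - z * cis (- \<theta>)) +
      cnj (poly q (cis \<theta>) / (1 - cnj z * cis \<theta>))) / 2) has_integral
      (2 * of_real pi * poly q z + 0) / 2) {0..2 * pi}"
    by (intro has_integral_divide has_integral_add 1)
  have R: "(poly q (cis \<theta>) / (1 - z * cis (- \<theta>)) +
      cnj (poly q (cis \<theta>) / (1 - cnj z * cis \<theta>))) / 2 =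
      of_real (Re (poly q (cis \<theta>))) / (1 - z * cis (- \<theta>))" for \<theta>
  proof -
    have "poly q (cis \<theta>) / (1 - z * cis (- \<theta>)) + cnj (poly q (cis \<theta>) / (1 - cnj z * cis \<theta>)) =
        (poly q (cis \<theta>) + cnj (poly q (cis \<theta>))) / (1 - z * cis (- \<theta>))"
      by (simp add: cis_cnj add_divide_distrib)
    also have "\<dots> = of_real (2 * Re (poly q (cis \<theta>))) / (1 - z * cis (- \<theta>))"
      by (simp only: complex_add_cnj)
    finally have e: "poly q (cis \<theta>) / (1 - z * cis (- \<theta>)) + cnj (poly q (cis \<theta>) / (1 - cnj z * cis \<theta>)) =
        of_real (2 * Re (poly q (cis \<theta>))) / (1 - z * cis (- \<theta>))" .
    have "of_real (2 * r) / d / 2 = of_real r / d" for r and d :: complex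
      by simp
    then show ?thesis
      by (simp only: e)
  qed
  from I show ?thesis
    by (simp only: R) simp
qed

lemma integral_cis_Re_poly:
  "((\<lambda>\<theta>. Re (poly q (cis \<theta>))) has_integral 2 * pi * Re (poly q 0)) {0..2 * pi}"
proof -
  have "((\<lambda>\<theta>. poly q (cis \<theta>) / (1 - 0 * cis (- \<theta>))) has_integral 2 * of_real pi * poly q 0) {0..2 * pi}"
    by (intro Cauchy_integral_cis holomorphic_intros) auto
  from has_integral_linear[OF this bounded_linear_Re] show ?thesis
    by (simp add: o_def)
qed

text \<open>Integration by parts in \<open>poly_eq_integral_Re\<close> replaces \<open>Re q\<close> by its primitive \<open>\<Psi>\<close>, without
  boundary terms because \<open>Re q\<close> has mean \<open>Re q(0) = 0\<close>. The derivative of the kernel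
  \<open>1 / (1 - z cnj \<zeta>)\<close> has modulus \<open>\<bar>z\<bar> / \<bar>1 - z cnj \<zeta>\<bar>\<^sup>2\<close>, the integral of which is known from the
  Poisson kernel. The point is that oscillation of \<open>Re q\<close> makes \<open>\<Psi>\<close>, and hence \<open>q\<close>, small, no matter
  how large \<open>Re q\<close> is.\<close>

lemma poly_bound_by_primitive_of_Re:
  assumes z: "cmod z < 1" and q: "poly q 0 = 0"
    and \<delta>: "\<And>\<theta>. \<theta> \<in> {0..2 * pi} \<Longrightarrow> \<bar>integral {0..\<theta>} (\<lambda>s. Re (poly q (cis s)))\<bar> \<le> \<delta>"
  shows "cmod (poly q z) \<le> 2 * \<delta> / (1 - cmod z)"
proof -
  define \<psi> where "\<psi> = (\<lambda>\<theta>. Re (poly q (cis \<theta>)))"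
  define \<Psi> where "\<Psi> = (\<lambda>\<theta>. integral {0..\<theta>} \<psi>)"
  define K where "K = (\<lambda>\<theta>. 1 / (1 - z * cis (- \<theta>)))"
  define K' where "K' = (\<lambda>\<theta>. - (\<i> * z * cis (- \<theta>)) / (1 - z * cis (- \<theta>))\<^sup>2)"
  note nz = one_minus_mult_cis_neq_0[OF z]
  have \<delta>0: "0 \<le> \<delta>"
    using \<delta>[of 0] by simp
  have cont: "continuous_on S \<psi>" for S
    unfolding \<psi>_def by (intro continuous_intros)
  have \<Psi>': "(\<Psi> has_vector_derivative \<psi> \<theta>) (at \<theta> within {0..2 * pi})" if "\<theta> \<in> {0..2 * pi}" for \<theta>
    unfolding \<Psi>_def by (rule integral_has_vector_derivative[OF cont that])
  have K'_deriv: "(K has_vector_derivative K' \<theta>) (at \<theta> within S)" for \<theta> S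
  proof -
    have "((\<lambda>\<theta>. 1 - z * cis (- \<theta>)) has_vector_derivative \<i> * z * cis (- \<theta>)) (at \<theta> within S)"
      by (auto intro!: derivative_eq_intros has_derivative_cis
          simp: has_vector_derivative_def algebra_simps scaleR_conv_of_real)
    moreover have "(inverse has_field_derivative - (inverse (1 - z * cis (- \<theta>)) ^ Suc (Suc 0)))
        (at (1 - z * cis (- \<theta>)) within T)" for T
      by (rule DERIV_inverse[OF nz])
    ultimately have "((inverse \<circ> (\<lambda>\<theta>. 1 - z * cis (- \<theta>))) has_vector_derivative
        \<i> * z * cis (- \<theta>) * - (inverse (1 - z * cis (- \<theta>)) ^ Suc (Suc 0))) (at \<theta> within S)"
      by (rule field_vector_diff_chain_within)
    then show ?thesis
      by (simp add: K_def K'_def o_def field_simps power2_eq_square)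
  qed
  have "((\<lambda>\<theta>. of_real (\<psi> \<theta>) * K \<theta> + of_real (\<Psi> \<theta>) * K' \<theta>) has_integral
      of_real (\<Psi> (2 * pi)) * K (2 * pi) - of_real (\<Psi> 0) * K 0) {0..2 * pi}"
  proof (rule fundamental_theorem_of_calculus)
    fix \<theta> assume "\<theta> \<in> {0..2 * pi}"
    then have "(\<Psi> has_real_derivative \<psi> \<theta>) (at \<theta> within {0..2 * pi})"
      using \<Psi>' by (simp add: has_real_derivative_iff_has_vector_derivative)
    from has_vector_derivative_mult[OF has_vector_derivative_of_real[OF this] K'_deriv]
    show "((\<lambda>\<theta>. of_real (\<Psi> \<theta>) * K \<theta>) has_vector_derivative
        of_real (\<psi> \<theta>) * K \<theta> + of_real (\<Psi> \<theta>) * K' \<theta>) (at \<theta> within {0..2 * pi})"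
      by (simp add: add.commute)
  qed simp
  moreover have "\<Psi> (2 * pi) = 0" "\<Psi> 0 = 0"
    using integral_cis_Re_poly[of q] q by (auto simp: \<Psi>_def \<psi>_def integral_unique)
  moreover have "((\<lambda>\<theta>. of_real (\<psi> \<theta>) * K \<theta>) has_integral of_real pi * poly q z) {0..2 * pi}"
    using poly_eq_integral_Re[OF z q] by (simp add: \<psi>_def K_def)
  ultimately have "((\<lambda>\<theta>. (of_real (\<psi> \<theta>) * K \<theta> + of_real (\<Psi> \<theta>) * K' \<theta>) -
      of_real (\<psi> \<theta>) * K \<theta>) has_integral 0 - of_real pi * poly q z) {0..2 * pi}"
    by (intro has_integral_diff) simp_all
  then have \<Psi>K': "((\<lambda>\<theta>. of_real (\<Psi> \<theta>) * K' \<theta>) has_integral - (of_real pi * poly q z)) {0..2 * pi}"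
    by simp
  have P: "((\<lambda>\<theta>. \<delta> * cmod z * (1 / (cmod (1 - z * cis (- \<theta>)))\<^sup>2)) has_integral
      \<delta> * cmod z * (2 * pi / (1 - (cmod z)\<^sup>2))) {0..2 * pi}"
    by (intro has_integral_mult_right Poisson_integral_one z)
  have "cmod (of_real pi * poly q z) \<le> \<delta> * cmod z * (2 * pi / (1 - (cmod z)\<^sup>2))"
  proof -
    have "cmod (integral {0..2 * pi} (\<lambda>\<theta>. of_real (\<Psi> \<theta>) * K' \<theta>)) \<le>
        integral {0..2 * pi} (\<lambda>\<theta>. \<delta> * cmod z * (1 / (cmod (1 - z * cis (- \<theta>)))\<^sup>2))"
    proof (rule Henstock_Kurzweil_Integration.integral_norm_bound_integral)
      fix \<theta> :: real assume "\<theta> \<in> {0..2 * pi}"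
      then have "\<bar>\<Psi> \<theta>\<bar> \<le> \<delta>"
        using \<delta> by (simp add: \<Psi>_def \<psi>_def)
      then have "\<bar>\<Psi> \<theta>\<bar> * (cmod z / (cmod (1 - z * cis (- \<theta>)))\<^sup>2) \<le>
          \<delta> * (cmod z / (cmod (1 - z * cis (- \<theta>)))\<^sup>2)"
        by (intro mult_right_mono) auto
      then show "cmod (of_real (\<Psi> \<theta>) * K' \<theta>) \<le> \<delta> * cmod z * (1 / (cmod (1 - z * cis (- \<theta>)))\<^sup>2)"
        by (simp add: K'_def norm_mult norm_divide norm_power)
    qed (use \<Psi>K' P in \<open>auto simp: has_integral_integrable\<close>)
    then show ?thesis
      using integral_unique[OF \<Psi>K'] integral_unique[OF P] by simp
  qed
  then have "pi * cmod (poly q z) \<le> pi * (2 * \<delta> * (cmod z / (1 - (cmod z)\<^sup>2)))"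
    by (simp add: norm_mult ac_simps)
  then have "cmod (poly q z) \<le> 2 * \<delta> * (cmod z / (1 - (cmod z)\<^sup>2))"
    by (rule mult_left_le_imp_le) simp
  also have "\<dots> \<le> 2 * \<delta> * (1 / (1 - cmod z))"
  proof (intro mult_left_mono)
    have "1 - (cmod z)\<^sup>2 = (1 - cmod z) * (1 + cmod z)"
      by (simp add: power2_eq_square algebra_simps)
    moreover have "cmod z / (1 + cmod z) \<le> 1"
      by (subst divide_le_eq_1_pos) (auto intro: add_pos_nonneg)
    then have "cmod z / (1 + cmod z) / (1 - cmod z) \<le> 1 / (1 - cmod z)"
      using z by (intro divide_right_mono) auto
    ultimately show "cmod z / (1 - (cmod z)\<^sup>2) \<le> 1 / (1 - cmod z)"
      by (simp add: mult.commute)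
  qed (use \<delta>0 in auto)
  finally show ?thesis
    by simp
qed

section \<open>Density of the real parts of polynomials on the circle\<close>

lemma nn_integral_abs_diff_triangle:
  fixes f g h :: "'a \<Rightarrow> real"
  assumes [measurable]: "f \<in> borel_measurable M" "g \<in> borel_measurable M" "h \<in> borel_measurable M"
  shows "(\<integral>\<^sup>+x. ennreal \<bar>f x - h x\<bar> \<partial>M) \<le>
    (\<integral>\<^sup>+x. ennreal \<bar>f x - g x\<bar> \<partial>M) + (\<integral>\<^sup>+x. ennreal \<bar>g x - h x\<bar> \<partial>M)"
proof -
  have "(\<integral>\<^sup>+x. ennreal \<bar>f x - h x\<bar> \<partial>M) \<le> (\<integral>\<^sup>+x. ennreal \<bar>f x - g x\<bar> + ennreal \<bar>g x - h x\<bar> \<partial>M)"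
    by (intro nn_integral_mono) (simp flip: ennreal_plus add: ennreal_leI)
  also have "\<dots> = (\<integral>\<^sup>+x. ennreal \<bar>f x - g x\<bar> \<partial>M) + (\<integral>\<^sup>+x. ennreal \<bar>g x - h x\<bar> \<partial>M)"
    by (intro nn_integral_add) auto
  finally show ?thesis .
qed

lemma ennreal_add_less_halves:
  assumes "a < ennreal (e / 2)" "b < ennreal (e / 2)"
  shows "a + b < ennreal e"
proof -
  have "0 < e / 2"
    using assms(1) by (metis ennreal_neg linorder_not_less not_less_zero)
  moreover have "a + b < ennreal (e / 2) + ennreal (e / 2)"
    using assms by (intro add_strict_mono) 
  ultimately show ?thesis
    by (simp flip: ennreal_plus)
qed

text \<open>By regularity of \<open>M\<close> the set is squeezed between a compact set and an open set of nearly equal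
  measure, and Urysohn's lemma provides a function that separates the compact set from the complement
  of the open one.\<close>

lemma indicator_approx_continuous:
  fixes M :: "complex measure"
  assumes "finite_measure M" and sets: "sets M = sets borel" and A: "A \<in> sets M" and e: "0 < e"
  shows "\<exists>g. continuous_on UNIV g \<and> (\<integral>\<^sup>+x. ennreal \<bar>indicator A x - g x\<bar> \<partial>M) < ennreal e"
proof -
  interpret finite_measure M by fact
  have A': "A \<in> sets borel"
    using A sets by simp
  have fin: "emeasure M (space M) \<noteq> \<infinity>"
    by simp
  have "\<exists>K. K \<subseteq> A \<and> compact K \<and> measure M A < measure M K + e / 2"
  proof (cases "measure M A = 0")
    case True
    then show ?thesis
      using e by (intro exI[of _ "{}"]) auto
  next
    case False
    then have "0 < measure M A"
      by (simp add: zero_less_measure_iff)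
    then have "ennreal (measure M A - e / 2) < emeasure M A"
      using e by (simp add: emeasure_eq_measure ennreal_lessI)
    also have "emeasure M A = (SUP K \<in> {K. K \<subseteq> A \<and> compact K}. emeasure M K)"
      by (rule inner_regular[OF sets fin A'])
    finally obtain K where "K \<subseteq> A" "compact K" "ennreal (measure M A - e / 2) < ennreal (measure M K)"
      unfolding less_SUP_iff by (auto simp: emeasure_eq_measure)
    moreover from this(3) have "measure M A - e / 2 < measure M K"
      by (metis ennreal_leI not_less)
    ultimately show ?thesis
      by (intro exI[of _ K]) auto
  qed
  then obtain K where K: "K \<subseteq> A" "compact K" "measure M A < measure M K + e / 2"
    by blast
  have "\<exists>U. A \<subseteq> U \<and> open U \<and> measure M U < measure M A + e / 2"
  proof -
    have "emeasure M A < ennreal (measure M A + e / 2)"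
      using e by (simp add: emeasure_eq_measure ennreal_lessI add_nonneg_pos del: ennreal_plus)
    then have "(INF U \<in> {U. A \<subseteq> U \<and> open U}. emeasure M U) < ennreal (measure M A + e / 2)"
      using outer_regular[OF sets fin A'] by simp
    then show ?thesis
      unfolding INF_less_iff by (auto simp: emeasure_eq_measure ennreal_less_iff simp del: ennreal_plus)
  qed
  then obtain U where U: "A \<subseteq> U" "open U" "measure M U < measure M A + e / 2"
    by blast
  have "closed K" "closed (- U)" "K \<inter> - U = {}"
    using K U by (auto simp: compact_imp_closed)
  then obtain g :: "complex \<Rightarrow> real" where g: "continuous_on UNIV g" "\<And>x. g x \<in> closed_segment 1 0"
      "\<And>x. x \<in> K \<Longrightarrow> g x = 1" "\<And>x. x \<in> - U \<Longrightarrow> g x = 0"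
    by (rule Urysohn) blast
  have [measurable]: "K \<in> sets M" "U \<in> sets M"
    using K U sets by (auto simp: compact_imp_closed)
  have "(\<integral>\<^sup>+x. ennreal \<bar>indicator A x - g x\<bar> \<partial>M) \<le> (\<integral>\<^sup>+x. indicator (U - K) x \<partial>M)"
  proof (intro nn_integral_mono)
    fix x
    have "0 \<le> g x" "g x \<le> 1"
      using g(2)[of x] by (auto simp: closed_segment_eq_real_ivl)
    then show "ennreal \<bar>indicator A x - g x\<bar> \<le> indicator (U - K) x"
      using g(3,4)[of x] K(1) U(1) by (auto simp: indicator_def ennreal_le_1)
  qed
  also have "\<dots> = ennreal (measure M (U - K))"
    by (simp add: emeasure_eq_measure)
  also have "measure M (U - K) = measure M U - measure M K"
    using K U by (intro finite_measure_Diff) auto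
  also have "ennreal \<dots> < ennreal e"
    using K(3) U(3) e by (intro ennreal_lessI) auto
  finally show ?thesis
    using g(1) by blast
qed

lemma integrable_approx_continuous:
  fixes M :: "complex measure" and f :: "complex \<Rightarrow> real"
  assumes M: "finite_measure M" and sets [measurable_cong]: "sets M = sets borel" and f: "integrable M f"
  shows "\<forall>e>0. \<exists>g. continuous_on UNIV g \<and> (\<integral>\<^sup>+x. ennreal \<bar>f x - g x\<bar> \<partial>M) < ennreal e"
  using f
proof (induction rule: integrable_induct)
  case (base A c)
  show ?case
  proof (intro allI impI)
    fix e :: real assume e: "0 < e"
    then have e': "0 < e / (\<bar>c\<bar> + 1)"
      by simp
    from indicator_approx_continuous[OF M sets base(1) this] obtain g where
      g: "continuous_on UNIV g" "(\<integral>\<^sup>+x. ennreal \<bar>indicator A x - g x\<bar> \<partial>M) < ennreal (e / (\<bar>c\<bar> + 1))"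
      by blast
    have [measurable]: "g \<in> borel_measurable borel" "A \<in> sets borel"
      using g(1) base(1) sets by (auto intro: borel_measurable_continuous_onI)
    have "(\<integral>\<^sup>+x. ennreal \<bar>indicator A x *\<^sub>R c - g x * c\<bar> \<partial>M) \<le>
        (\<integral>\<^sup>+x. ennreal (\<bar>c\<bar> + 1) * ennreal \<bar>indicator A x - g x\<bar> \<partial>M)"
    proof (intro nn_integral_mono)
      fix x
      have "\<bar>indicator A x *\<^sub>R c - g x * c\<bar> = \<bar>c\<bar> * \<bar>indicator A x - g x\<bar>"
        by (simp add: mult.commute[of _ c] flip: right_diff_distrib abs_mult)
      also have "\<dots> \<le> (\<bar>c\<bar> + 1) * \<bar>indicator A x - g x\<bar>"
        by (intro mult_right_mono) auto
      finally show "ennreal \<bar>indicator A x *\<^sub>R c - g x * c\<bar> \<le>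
          ennreal (\<bar>c\<bar> + 1) * ennreal \<bar>indicator A x - g x\<bar>"
        by (subst ennreal_mult[symmetric]) (auto intro!: ennreal_leI)
    qed
    also have "\<dots> = ennreal (\<bar>c\<bar> + 1) * (\<integral>\<^sup>+x. ennreal \<bar>indicator A x - g x\<bar> \<partial>M)"
      by (intro nn_integral_cmult) auto
    also have "\<dots> < ennreal (\<bar>c\<bar> + 1) * ennreal (e / (\<bar>c\<bar> + 1))"
      using g(2) by (intro ennreal_mult_strict_left_mono) (auto simp: add_nonneg_pos simp del: ennreal_plus)
    also have "\<dots> = ennreal e"
      by (subst ennreal_mult'[symmetric]) auto
    finally show "\<exists>g. continuous_on UNIV g \<and> (\<integral>\<^sup>+x. ennreal \<bar>indicator A x *\<^sub>R c - g x\<bar> \<partial>M) < ennreal e"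
      using g(1) by (intro exI[of _ "\<lambda>x. g x * c"]) (auto intro!: continuous_intros)
  qed
next
  case (add f1 f2)
  show ?case
  proof (intro allI impI)
    fix e :: real assume e: "0 < e"
    then have "0 < e / 2"
      by simp
    with add obtain g1 g2 where
      g: "continuous_on UNIV g1" "(\<integral>\<^sup>+x. ennreal \<bar>f1 x - g1 x\<bar> \<partial>M) < ennreal (e / 2)"
        "continuous_on UNIV g2" "(\<integral>\<^sup>+x. ennreal \<bar>f2 x - g2 x\<bar> \<partial>M) < ennreal (e / 2)"
      by meson
    have [measurable]: "g1 \<in> borel_measurable borel" "g2 \<in> borel_measurable borel"
      "f1 \<in> borel_measurable M" "f2 \<in> borel_measurable M"
      using g add by (auto intro: borel_measurable_continuous_onI)
    have "(\<integral>\<^sup>+x. ennreal \<bar>(f1 x + f2 x) - (g1 x + g2 x)\<bar> \<partial>M) \<le>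
        (\<integral>\<^sup>+x. ennreal \<bar>(f1 x + f2 x) - (g1 x + f2 x)\<bar> \<partial>M) +
        (\<integral>\<^sup>+x. ennreal \<bar>(g1 x + f2 x) - (g1 x + g2 x)\<bar> \<partial>M)"
      by (intro nn_integral_abs_diff_triangle) auto
    also have "\<dots> < ennreal e"
      using g by (intro ennreal_add_less_halves) simp_all
    finally show "\<exists>g. continuous_on UNIV g \<and> (\<integral>\<^sup>+x. ennreal \<bar>(f1 x + f2 x) - g x\<bar> \<partial>M) < ennreal e"
      using g by (intro exI[of _ "\<lambda>x. g1 x + g2 x"]) (auto intro!: continuous_intros)
  qed
next
  case (lim f s)
  show ?case
  proof (intro allI impI)
    fix e :: real assume e: "0 < e"
    have [measurable]: "f \<in> borel_measurable M" "\<And>i. s i \<in> borel_measurable M"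
      using lim by auto
    have "(\<lambda>i. \<integral>\<^sup>+x. norm (f x - s i x) \<partial>M) \<longlonglongrightarrow> 0"
    proof (rule nn_integral_dominated_convergence_norm)
      show "AE x in M. norm (s j x) \<le> 2 * norm (f x)" for j
        using lim.hyps by (intro AE_I2) blast
      show "(\<integral>\<^sup>+x. ennreal (2 * norm (f x)) \<partial>M) < \<infinity>"
        using integrable_mult_right[OF integrable_norm[OF \<open>integrable M f\<close>], of 2]
        unfolding integrable_iff_bounded by (simp add: abs_mult)
      show "AE x in M. (\<lambda>i. s i x) \<longlonglongrightarrow> f x"
        using lim.hyps by (intro AE_I2) blast
    qed auto
    from order_tendstoD(2)[OF this, of "ennreal (e / 2)"] e
    obtain i where i: "(\<integral>\<^sup>+x. norm (f x - s i x) \<partial>M) < ennreal (e / 2)"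
      by (auto simp: eventually_sequentially)
    from lim.IH[of i] e obtain g where
      g: "continuous_on UNIV g" "(\<integral>\<^sup>+x. ennreal \<bar>s i x - g x\<bar> \<partial>M) < ennreal (e / 2)"
      by (meson half_gt_zero)
    have [measurable]: "g \<in> borel_measurable borel"
      using g(1) by (auto intro: borel_measurable_continuous_onI)
    have "(\<integral>\<^sup>+x. ennreal \<bar>f x - g x\<bar> \<partial>M) \<le>
        (\<integral>\<^sup>+x. ennreal \<bar>f x - s i x\<bar> \<partial>M) + (\<integral>\<^sup>+x. ennreal \<bar>s i x - g x\<bar> \<partial>M)"
      by (intro nn_integral_abs_diff_triangle) auto
    also have "\<dots> < ennreal e"
      using i g by (intro ennreal_add_less_halves) (simp_all)
    finally show "\<exists>g. continuous_on UNIV g \<and> (\<integral>\<^sup>+x. ennreal \<bar>f x - g x\<bar> \<partial>M) < ennreal e"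
      using g(1) by blast
  qed
qed

definition Re_poly_on_circle :: "(complex \<Rightarrow> real) set" where
  "Re_poly_on_circle = {f. \<exists>p. \<forall>z\<in>sphere 0 1. f z = Re (poly p z)}"

lemma Re_poly_on_circle_add:
  "f \<in> Re_poly_on_circle \<Longrightarrow> g \<in> Re_poly_on_circle \<Longrightarrow> (\<lambda>z. f z + g z) \<in> Re_poly_on_circle"
  unfolding Re_poly_on_circle_def by (clarsimp, metis poly_add plus_complex.sel(1))

lemma Re_poly_on_circle_cong:
  "g \<in> Re_poly_on_circle \<Longrightarrow> (\<And>z. cmod z = 1 \<Longrightarrow> f z = g z) \<Longrightarrow> f \<in> Re_poly_on_circle"
  unfolding Re_poly_on_circle_def by auto

lemma Re_poly_mem: "(\<lambda>z. Re (poly p z)) \<in> Re_poly_on_circle"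
  unfolding Re_poly_on_circle_def by blast

lemma cnj_mult_self_circle: "cmod z = 1 \<Longrightarrow> cnj z * z = 1"
  using complex_norm_square[of z] by (simp add: mult.commute)

text \<open>On the circle \<open>cnj z\<close> is the inverse of \<open>z\<close>, so that a negative power of \<open>z\<close> has the same real part as
  a polynomial, by conjugation. This makes the real parts of polynomials an algebra and puts them in
  the scope of the Stone--Weierstrass theorem.\<close>

lemma Re_cnj_power_mult_poly_mem: "(\<lambda>z. Re (cnj z ^ k * poly p z)) \<in> Re_poly_on_circle"
proof (induction p arbitrary: k)
  case 0
  show ?case
    using Re_poly_mem[of 0] by simp
next
  case (pCons a p)
  have 1: "(\<lambda>z. Re (cnj z ^ k * a)) \<in> Re_poly_on_circle"
    by (rule Re_poly_on_circle_cong[OF Re_poly_mem[of "monom (cnj a) k"]])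
      (simp add: poly_monom flip: complex_cnj_power)
  have 2: "(\<lambda>z. Re (cnj z ^ k * (z * poly p z))) \<in> Re_poly_on_circle"
  proof (cases k)
    case 0
    then show ?thesis
      using Re_poly_mem[of "pCons 0 p"] by simp
  next
    case (Suc l)
    show ?thesis
    proof (rule Re_poly_on_circle_cong[OF pCons(2)[of l]])
      fix z :: complex assume "cmod z = 1"
      then have "cnj z ^ k * (z * poly p z) = (cnj z * z) * (cnj z ^ l * poly p z)"
        by (simp only: Suc power_Suc ac_simps)
      then show "Re (cnj z ^ k * (z * poly p z)) = Re (cnj z ^ l * poly p z)"
        by (simp only: cnj_mult_self_circle[OF \<open>cmod z = 1\<close>] mult_1_left)
    qed
  qed
  show ?case
    using Re_poly_on_circle_add[OF 1 2] by (simp add: algebra_simps)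
qed

lemma Re_poly_mult_cnj_poly_mem:
  "(\<lambda>z. Re (cnj z ^ k * poly p z * cnj (poly q z))) \<in> Re_poly_on_circle"
proof (induction q arbitrary: k)
  case 0
  show ?case
    using Re_poly_mem[of 0] by simp
next
  case (pCons a q)
  have "(\<lambda>z. Re (cnj z ^ k * poly (smult (cnj a) p) z)) \<in> Re_poly_on_circle"
    by (rule Re_cnj_power_mult_poly_mem)
  from Re_poly_on_circle_add[OF this pCons(2)[of "Suc k"]] show ?case
    by (rule Re_poly_on_circle_cong) (simp add: algebra_simps)
qed

text \<open>\<open>2 Re p Re q = Re (p q) + Re (p cnj q)\<close>.\<close>

lemma Re_poly_on_circle_mult:
  assumes "f \<in> Re_poly_on_circle" "g \<in> Re_poly_on_circle"
  shows "(\<lambda>z. f z * g z) \<in> Re_poly_on_circle"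
proof -
  from assms obtain p q where pq: "\<And>z. cmod z = 1 \<Longrightarrow> f z = Re (poly p z)"
      "\<And>z. cmod z = 1 \<Longrightarrow> g z = Re (poly q z)"
    by (auto simp: Re_poly_on_circle_def)
  have "(\<lambda>z. Re (poly (smult (1 / 2) (p * q)) z)) \<in> Re_poly_on_circle"
    by (rule Re_poly_mem)
  from Re_poly_on_circle_add[OF this Re_poly_mult_cnj_poly_mem[of 0 "smult (1 / 2) p" q]]
  show ?thesis
    by (rule Re_poly_on_circle_cong) (simp add: pq field_simps)
qed

lemma Re_poly_uniformly_dense_on_circle:
  assumes f: "continuous_on (sphere 0 1) f" and e: "0 < e"
  shows "\<exists>p. \<forall>z\<in>sphere 0 1. \<bar>f z - Re (poly p z)\<bar> < e"
proof -
  interpret function_ring_on Re_poly_on_circle "sphere 0 1"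
  proof
    show "continuous_on (sphere 0 1) f" if f: "f \<in> Re_poly_on_circle" for f
    proof -
      from f obtain p where p: "\<And>z. z \<in> sphere 0 1 \<Longrightarrow> f z = Re (poly p z)"
        by (auto simp: Re_poly_on_circle_def)
      have "continuous_on (sphere 0 1) (\<lambda>z. Re (poly p z))"
        by (intro continuous_intros)
      then show ?thesis
        by (rule continuous_on_eq) (simp add: p)
    qed
    show "(\<lambda>_. c) \<in> Re_poly_on_circle" for c
      using Re_poly_mem[of "[:of_real c:]"] by simp
    fix x y :: complex assume "x \<in> sphere 0 1" "y \<in> sphere 0 1" "x \<noteq> y"
    then have "Re x \<noteq> Re y \<or> Im x \<noteq> Im y"
      by (auto simp: complex_eq_iff)
    then show "\<exists>f\<in>Re_poly_on_circle. f x \<noteq> f y"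
      using Re_poly_mem[of "[:0, 1:]"] Re_poly_mem[of "[:0, - \<i>:]"] by auto
  qed (auto intro: Re_poly_on_circle_add Re_poly_on_circle_mult)
  from Stone_Weierstrass_basic[OF f e] obtain g where
    g: "g \<in> Re_poly_on_circle" "\<forall>z\<in>sphere 0 1. \<bar>f z - g z\<bar> < e"
    by blast
  then obtain p where "\<forall>z\<in>sphere 0 1. g z = Re (poly p z)"
    by (auto simp: Re_poly_on_circle_def)
  with g(2) show ?thesis
    by (intro exI[of _ p]) metis
qed

text \<open>The pointwise bound on the approximants is essential: later \<open>Re q\<close> stands in an exponent, where
  closeness in \<open>L\<^sup>1\<close> alone gives no control. It is obtained by clipping the continuous approximant
  before a polynomial is chosen.\<close>

lemma bounded_approx_Re_poly:
  fixes M :: "complex measure" and f :: "complex \<Rightarrow> real"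
  assumes M: "finite_measure M" and sets [measurable_cong]: "sets M = sets borel"
    and circle: "AE z in M. cmod z = 1"
    and f [measurable]: "f \<in> borel_measurable borel" and B: "\<And>z. \<bar>f z\<bar> \<le> B" and e: "0 < e"
  shows "\<exists>q. (\<forall>z\<in>sphere 0 1. \<bar>Re (poly q z)\<bar> \<le> B + 1) \<and>
    (\<integral>\<^sup>+z. ennreal \<bar>f z - Re (poly q z)\<bar> \<partial>M) < ennreal e"
proof -
  interpret finite_measure M by fact
  have "integrable M f"
    using B by (intro integrable_const_bound[of _ B]) auto
  from integrable_approx_continuous[OF M sets this, rule_format, of "e / 2"] e obtain g where
    g: "continuous_on UNIV g" "(\<integral>\<^sup>+x. ennreal \<bar>f x - g x\<bar> \<partial>M) < ennreal (e / 2)"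
    by auto
  define h where "h = (\<lambda>x. max (- B) (min B (g x)))"
  have h: "continuous_on S h" for S
    unfolding h_def using g(1) by (intro continuous_intros) (auto intro: continuous_on_subset)
  have [measurable]: "g \<in> borel_measurable borel" "h \<in> borel_measurable borel"
    using g(1) h[of UNIV] by (auto intro: borel_measurable_continuous_onI)
  define k where "k = measure M (space M) + 1"
  have k: "0 < k"
    by (simp add: k_def add_nonneg_pos)
  define d where "d = min 1 (e / 2 / k)"
  have d: "0 < d"
    using e k by (simp add: d_def)
  from Re_poly_uniformly_dense_on_circle[OF h d] obtain q where
    "\<forall>z\<in>sphere 0 1. \<bar>h z - Re (poly q z)\<bar> < d" ..
  then have q: "\<And>z. cmod z = 1 \<Longrightarrow> \<bar>h z - Re (poly q z)\<bar> < d"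
    by simp
  have "(\<integral>\<^sup>+x. ennreal \<bar>f x - h x\<bar> \<partial>M) \<le> (\<integral>\<^sup>+x. ennreal \<bar>f x - g x\<bar> \<partial>M)"
  proof (intro nn_integral_mono ennreal_leI)
    show "\<bar>f x - h x\<bar> \<le> \<bar>f x - g x\<bar>" for x
      using B[of x] unfolding h_def by linarith
  qed
  with g(2) have fh: "(\<integral>\<^sup>+x. ennreal \<bar>f x - h x\<bar> \<partial>M) < ennreal (e / 2)"
    by simp
  have "(\<integral>\<^sup>+x. ennreal \<bar>h x - Re (poly q x)\<bar> \<partial>M) \<le> (\<integral>\<^sup>+x. ennreal d \<partial>M)"
    using circle by (intro nn_integral_mono_AE) (auto elim!: eventually_mono intro!: ennreal_leI dest: q)
  also have "\<dots> = ennreal (d * measure M (space M))"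
    using d by (simp add: emeasure_eq_measure ennreal_mult)
  also have "\<dots> < ennreal (e / 2)"
  proof (rule ennreal_lessI)
    have "d * measure M (space M) < d * k"
      using d by (simp add: k_def)
    also have "\<dots> \<le> e / 2 / k * k"
      using k by (intro mult_right_mono) (auto simp: d_def)
    finally show "d * measure M (space M) < e / 2"
      using k by simp
  qed (use e in simp)
  finally have hq: "(\<integral>\<^sup>+x. ennreal \<bar>h x - Re (poly q x)\<bar> \<partial>M) < ennreal (e / 2)" .
  have "(\<integral>\<^sup>+z. ennreal \<bar>f z - Re (poly q z)\<bar> \<partial>M) \<le>
      (\<integral>\<^sup>+z. ennreal \<bar>f z - h z\<bar> \<partial>M) + (\<integral>\<^sup>+z. ennreal \<bar>h z - Re (poly q z)\<bar> \<partial>M)"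
    by (intro nn_integral_abs_diff_triangle) auto
  also have "\<dots> < ennreal e"
    by (intro ennreal_add_less_halves fh hq)
  finally have "(\<integral>\<^sup>+z. ennreal \<bar>f z - Re (poly q z)\<bar> \<partial>M) < ennreal e" .
  moreover have "\<bar>Re (poly q z)\<bar> \<le> B + 1" if "cmod z = 1" for z
  proof -
    have "0 \<le> B"
      using B[of z] by linarith
    then have "\<bar>h z\<bar> \<le> B"
      by (auto simp: h_def)
    with q[OF that] show ?thesis
      by (auto simp: d_def)
  qed
  ultimately show ?thesis
    by (intro exI[of _ q]) simp
qed

section \<open>Arclength measure\<close>

lemma borel_measurable_cis [measurable]: "cis \<in> borel_measurable borel"
  by (intro borel_measurable_continuous_onI continuous_intros)

lemma sets_circle_measure [simp, measurable_cong]: "sets circle_measure = sets borel"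
  and space_circle_measure [simp]: "space circle_measure = UNIV"
  by (simp_all add: circle_measure_def)

text \<open>The right endpoint is included, at no cost, in order to work with compact intervals.\<close>

lemma nn_integral_circle_measure:
  assumes [measurable]: "f \<in> borel_measurable borel"
  shows "(\<integral>\<^sup>+z. f z \<partial>circle_measure) =
    ennreal (1 / (2 * pi)) * (\<integral>\<^sup>+\<theta>. f (cis \<theta>) * indicator {0..2 * pi} \<theta> \<partial>lborel)"
proof -
  have "(\<integral>\<^sup>+z. f z \<partial>circle_measure) = (\<integral>\<^sup>+\<theta>. f (cis \<theta>) \<partial>uniform_measure lborel {0..<2 * pi})"
    unfolding circle_measure_def by (intro nn_integral_distr) measurable
  also have "\<dots> = (\<integral>\<^sup>+\<theta>. f (cis \<theta>) * indicator {0..<2 * pi} \<theta> \<partial>lborel) / ennreal (2 * pi)"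
    by (subst nn_integral_uniform_measure) auto
  also have "(\<integral>\<^sup>+\<theta>. f (cis \<theta>) * indicator {0..<2 * pi} \<theta> \<partial>lborel) =
      (\<integral>\<^sup>+\<theta>. f (cis \<theta>) * indicator {0..2 * pi} \<theta> \<partial>lborel)"
    using AE_lborel_singleton[of "2 * pi"]
    by (intro nn_integral_cong_AE) (auto simp: indicator_def elim!: eventually_mono)
  also have "\<dots> / ennreal (2 * pi) = ennreal (1 / (2 * pi)) * \<dots>"
    by (simp add: divide_ennreal_def inverse_ennreal mult.commute inverse_eq_divide)
  finally show ?thesis .
qed

lemma finite_circle_measure: "finite_measure circle_measure"
proof (rule finite_measureI)
  have "emeasure circle_measure UNIV = (\<integral>\<^sup>+z. 1 \<partial>circle_measure)"
    by simp
  also have "\<dots> = ennreal (1 / (2 * pi)) * ennreal (2 * pi)"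
    by (subst nn_integral_circle_measure) auto
  also have "\<dots> < \<infinity>"
    by (simp add: ennreal_mult_less_top)
  finally show "emeasure circle_measure (space circle_measure) \<noteq> \<infinity>"
    by simp
qed

lemma AE_circle_measure: "AE z in circle_measure. cmod z = 1"
  unfolding circle_measure_def by (subst AE_distr_iff) auto

lemma Arg2pi_cis: "0 \<le> \<theta> \<Longrightarrow> \<theta> < 2 * pi \<Longrightarrow> Arg2pi (cis \<theta>) = \<theta>"
  by (intro Arg2pi_unique[of 1]) (auto simp: cis_conv_exp)

lemma borel_measurable_Arg2pi [measurable]: "Arg2pi \<in> borel_measurable borel"
proof -
  have open_slit: "open (- \<real>\<^sub>\<ge>\<^sub>0 :: complex set)"
    using closed_nonneg_Reals_complex by (rule open_Compl)
  have "continuous_on (- \<real>\<^sub>\<ge>\<^sub>0) Arg2pi"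
    by (intro continuous_at_imp_continuous_on ballI continuous_at_Arg2pi) auto
  then have "(\<lambda>z. indicator (- \<real>\<^sub>\<ge>\<^sub>0) z *\<^sub>R Arg2pi z) \<in> borel_measurable borel"
    using open_slit by (intro borel_measurable_continuous_on_indicator) auto
  moreover have "indicator (- \<real>\<^sub>\<ge>\<^sub>0) z *\<^sub>R Arg2pi z = Arg2pi z" for z
    using Arg2pi_eq_0[of z] by (auto simp: indicator_def complex_nonneg_Reals_iff complex_is_Real_iff)
  ultimately show ?thesis
    by (simp only:)
qed

lemma bounded_borel_integrable_on:
  fixes f :: "real \<Rightarrow> real"
  assumes [measurable]: "f \<in> borel_measurable borel" and B: "\<And>x. \<bar>f x\<bar> \<le> B"
  shows "f integrable_on {a..b}"
    and "(\<And>x. 0 \<le> f x) \<Longrightarrow>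
      (\<integral>\<^sup>+x. ennreal (f x) * indicator {a..b} x \<partial>lborel) = ennreal (integral {a..b} f)"
proof -
  have int: "set_integrable lborel {a..b} f"
    unfolding set_integrable_def
  proof (rule integrableI_bounded_set_indicator)
    show "AE x in lborel. x \<in> {a..b} \<longrightarrow> norm (f x) \<le> B"
      using B by simp
  qed (auto simp: emeasure_lborel_Icc_eq)
  from set_borel_integral_eq_integral[OF this]
  have *: "f integrable_on {a..b}" "(LINT x:{a..b}|lborel. f x) = integral {a..b} f"
    by auto
  show "f integrable_on {a..b}"
    by (rule *)
  assume f: "\<And>x. 0 \<le> f x"
  have "(\<integral>\<^sup>+x. ennreal (f x) * indicator {a..b} x \<partial>lborel) =
      (\<integral>\<^sup>+x. ennreal (indicator {a..b} x *\<^sub>R f x) \<partial>lborel)"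
    by (intro nn_integral_cong) (auto simp: indicator_def)
  also have "\<dots> = ennreal (LINT x|lborel. indicator {a..b} x *\<^sub>R f x)"
    using int f by (intro nn_integral_eq_integral) (auto simp: set_integrable_def)
  also have "\<dots> = ennreal (integral {a..b} f)"
    using *(2) by (simp add: set_lebesgue_integral_def)
  finally show "(\<integral>\<^sup>+x. ennreal (f x) * indicator {a..b} x \<partial>lborel) = ennreal (integral {a..b} f)" .
qed

section \<open>Boundary functions with small primitive\<close>

text \<open>This is \<open>min K (log\<^sup>+ (1 / x))\<close>, with value \<open>K\<close> at \<open>x = 0\<close>. Taking the truncation inside the logarithm
  avoids a case distinction at \<open>0\<close>.\<close>

definition trunc_log :: "real \<Rightarrow> real \<Rightarrow> real" where
  "trunc_log K x = - ln (max (exp (- K)) (min 1 x))"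

lemma borel_measurable_trunc_log [measurable]: "trunc_log K \<in> borel_measurable borel"
  unfolding trunc_log_def by measurable

lemma borel_measurable_eln [measurable]: "eln \<in> borel_measurable borel"
  unfolding eln_def by measurable

lemma trunc_log_nonneg: "0 \<le> K \<Longrightarrow> 0 \<le> trunc_log K x"
  unfolding trunc_log_def by (simp add: ln_le_zero_iff less_max_iff_disj)

lemma trunc_log_le: "trunc_log K x \<le> K"
proof -
  have "ln (exp (- K)) \<le> ln (max (exp (- K)) (min 1 x))"
    by (subst ln_le_cancel_iff) (auto simp: less_max_iff_disj)
  then show ?thesis
    by (simp add: trunc_log_def)
qed

lemma trunc_log_mono: "K \<le> L \<Longrightarrow> trunc_log K x \<le> trunc_log L x"
proof -
  assume "K \<le> L"
  then have "max (exp (- L)) (min 1 x) \<le> max (exp (- K)) (min 1 x)"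
    by (intro max.mono) auto
  then show ?thesis
    unfolding trunc_log_def neg_le_iff_le
    by (subst ln_le_cancel_iff) (auto simp: less_max_iff_disj simp del: max.bounded_iff)
qed

text \<open>For \<open>c = 1\<close> and \<open>0 < x \<le> 1\<close> the exponential is at most \<open>1 / x\<close>, and for \<open>x > 1\<close> it is \<open>1\<close>.\<close>

lemma exp_trunc_log_mult_le:
  assumes "0 \<le> x" "0 \<le> c" "c \<le> 1" "0 \<le> K"
  shows "exp (c * trunc_log K x) * x \<le> 1 + x"
proof -
  have "c * trunc_log K x \<le> trunc_log K x"
    using assms trunc_log_nonneg[of K x] by (simp add: mult_left_le_one_le)
  then have "exp (c * trunc_log K x) * x \<le> exp (trunc_log K x) * x"
    using assms by (intro mult_right_mono) auto
  also have "\<dots> = x / max (exp (- K)) (min 1 x)"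
    unfolding trunc_log_def by (subst exp_minus, subst exp_ln) (auto simp: less_max_iff_disj field_simps)
  also have "\<dots> \<le> 1 + x"
  proof (cases "x \<le> 1")
    case True
    have "x / max (exp (- K)) (min 1 x) \<le> 1"
      using True by (subst divide_le_eq_1_pos) (auto simp: less_max_iff_disj)
    with assms show ?thesis by simp
  next
    case False
    then have "max (exp (- K)) (min 1 x) = 1"
      using assms by simp
    then show ?thesis by simp
  qed
  finally show ?thesis .
qed

lemma SUP_trunc_log:
  assumes x: "0 \<le> x"
  shows "(SUP n. ennreal (trunc_log (real n) x)) = e2ennreal (- eln (ennreal x))"
proof (cases "x = 0")
  case True
  have "trunc_log (real n) x = real n" for n
    using True by (simp add: trunc_log_def max_def)
  then show ?thesis
    using True by (simp add: eln_def ennreal_SUP_of_nat_eq_top ennreal_of_nat_eq_real_of_nat[symmetric])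
next
  case False
  with x have x: "0 < x"
    by simp
  then have eln: "eln (ennreal x) = ereal (ln x)"
    by (simp add: eln_def)
  have le: "trunc_log (real n) x \<le> max 0 (- ln x)" for n
    unfolding trunc_log_def using x
    by (cases "x \<le> 1") (auto simp: max_def min_def ln_le_zero_iff ln_ge_iff intro: order.trans)
  obtain n :: nat where n: "- ln x \<le> real n"
    using real_arch_simple by blast
  then have "exp (- real n) \<le> x"
    using x by (simp add: ln_ge_iff[symmetric])
  then have eq: "trunc_log (real n) x = max 0 (- ln x)"
    using x by (auto simp: trunc_log_def max_def min_def ln_le_zero_iff)
  have "(SUP n. ennreal (trunc_log (real n) x)) = ennreal (max 0 (- ln x))"
  proof (rule antisym)
    show "(SUP n. ennreal (trunc_log (real n) x)) \<le> ennreal (max 0 (- ln x))"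
      by (intro SUP_least ennreal_leI le)
    show "ennreal (max 0 (- ln x)) \<le> (SUP n. ennreal (trunc_log (real n) x))"
      by (rule SUP_upper2[of n]) (simp_all add: eq)
  qed
  also have "\<dots> = e2ennreal (- eln (ennreal x))"
    by (simp add: eln ennreal_max_0 ennreal.abs_eq[symmetric])
  finally show ?thesis .
qed

text \<open>An extended integral equal to \<open>- \<infinity>\<close> has an infinite negative part. The arc is taken closed, which
  makes it compact and hence measurable. Up to the points \<open>0\<close> and \<open>2 \<pi>\<close>, which are identified by
  \<open>cis\<close>, its preimage in \<open>[0, 2 \<pi>]\<close> is the interval.\<close>

lemma log_integral_infinite:
  assumes [measurable]: "W \<in> borel_measurable borel" and Ww: "\<And>z. cmod z = 1 \<Longrightarrow> W z = w z"
    and log: "\<And>I. circle_arc I \<Longrightarrow>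
      ext_set_integral circle_measure I (\<lambda>z. eln (ennreal (w z))) = - \<infinity>"
    and ab: "0 \<le> a" "a < b" "b \<le> 2 * pi"
  shows "(\<integral>\<^sup>+\<theta>. e2ennreal (- eln (ennreal (W (cis \<theta>)))) * indicator {a..b} \<theta> \<partial>lborel) = \<infinity>"
proof -
  define I where "I = cis ` {a..b}"
  have "circle_arc I"
    unfolding circle_arc_def I_def using ab by (intro exI[of _ a] exI[of _ b] exI[of _ "{a..b}"]) auto
  from log[OF this]
  have "(\<integral>\<^sup>+z. e2ennreal (- (if z \<in> I then eln (ennreal (w z)) else 0)) \<partial>circle_measure) = \<infinity>"
    unfolding ext_set_integral_def ext_integral_def
    by (cases "\<integral>\<^sup>+z. e2ennreal (if z \<in> I then eln (ennreal (w z)) else 0) \<partial>circle_measure";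
        cases "\<integral>\<^sup>+z. e2ennreal (- (if z \<in> I then eln (ennreal (w z)) else 0)) \<partial>circle_measure") auto
  also have "(\<integral>\<^sup>+z. e2ennreal (- (if z \<in> I then eln (ennreal (w z)) else 0)) \<partial>circle_measure) =
      (\<integral>\<^sup>+z. e2ennreal (- eln (ennreal (W z))) * indicator I z \<partial>circle_measure)"
    by (intro nn_integral_cong) (auto simp: indicator_def I_def Ww zero_ennreal.abs_eq[symmetric])
  also have "\<dots> = ennreal (1 / (2 * pi)) *
      (\<integral>\<^sup>+\<theta>. e2ennreal (- eln (ennreal (W (cis \<theta>)))) * indicator I (cis \<theta>) * indicator {0..2 * pi} \<theta> \<partial>lborel)"
  proof (rule nn_integral_circle_measure)
    have "closed I"
      unfolding I_def by (intro compact_imp_closed compact_continuous_image continuous_intros) auto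
    then have [measurable]: "I \<in> sets borel"
      by simp
    show "(\<lambda>z. e2ennreal (- eln (ennreal (W z))) * indicator I z) \<in> borel_measurable borel"
      by measurable
  qed
  finally have "(\<integral>\<^sup>+\<theta>. e2ennreal (- eln (ennreal (W (cis \<theta>)))) * indicator I (cis \<theta>) *
      indicator {0..2 * pi} \<theta> \<partial>lborel) = \<infinity>"
    by (simp add: ennreal_mult_eq_top_iff)
  moreover have "(\<integral>\<^sup>+\<theta>. e2ennreal (- eln (ennreal (W (cis \<theta>)))) * indicator I (cis \<theta>) *
      indicator {0..2 * pi} \<theta> \<partial>lborel) \<le>
      (\<integral>\<^sup>+\<theta>. e2ennreal (- eln (ennreal (W (cis \<theta>)))) * indicator {a..b} \<theta> \<partial>lborel)"
  proof (rule nn_integral_mono_AE)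
    show "AE \<theta> in lborel. e2ennreal (- eln (ennreal (W (cis \<theta>)))) * indicator I (cis \<theta>) *
        indicator {0..2 * pi} \<theta> \<le> e2ennreal (- eln (ennreal (W (cis \<theta>)))) * indicator {a..b} \<theta>"
      using AE_lborel_singleton[of 0] AE_lborel_singleton[of "2 * pi"]
    proof eventually_elim
      case (elim \<theta>)
      have "\<theta> \<in> {a..b}" if \<theta>: "0 \<le> \<theta>" "\<theta> \<le> 2 * pi" and "cis \<theta> \<in> I"
      proof -
        obtain s where s: "cis \<theta> = cis s" "s \<in> {a..b}"
          using \<open>cis \<theta> \<in> I\<close> by (auto simp: I_def)
        have \<theta>': "Arg2pi (cis \<theta>) = \<theta>"
          using \<theta> elim by (intro Arg2pi_cis) auto
        have "s \<noteq> 2 * pi"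
        proof
          assume "s = 2 * pi"
          then have "cis \<theta> = cis 0"
            using s(1) by simp
          then have "\<theta> = Arg2pi (cis 0)"
            using \<theta>' by simp
          then show False
            using elim(1) Arg2pi_cis[of 0] by simp
        qed
        then have "Arg2pi (cis s) = s"
          using s(2) ab by (intro Arg2pi_cis) auto
        then have "\<theta> = s"
          using \<theta>' unfolding s(1) by metis
        then show ?thesis
          using s(2) by blast
      qed
      then show ?case
        by (auto simp: indicator_def)
    qed
  qed
  ultimately show ?thesis
    by (metis infinity_ennreal_def top_unique)
qed

text \<open>Monotone convergence: the truncations increase to the negative part of the logarithm, which has
  infinite integral.\<close>

lemma trunc_log_integral_large:
  fixes v :: "real \<Rightarrow> real"
  assumes [measurable]: "v \<in> borel_measurable borel" and v: "\<And>\<theta>. 0 \<le> v \<theta>"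
    and inf: "(\<integral>\<^sup>+\<theta>. e2ennreal (- eln (ennreal (v \<theta>))) * indicator {a..b} \<theta> \<partial>lborel) = \<infinity>"
  shows "\<exists>n0::nat. \<forall>n\<ge>n0. C \<le> integral {a..b} (\<lambda>\<theta>. trunc_log (real n) (v \<theta>))"
proof -
  have bdd: "\<bar>trunc_log (real n) (v \<theta>)\<bar> \<le> real n" for n \<theta>
    using trunc_log_nonneg[of "real n" "v \<theta>"] trunc_log_le[of "real n" "v \<theta>"] by simp
  have I: "(\<integral>\<^sup>+\<theta>. ennreal (trunc_log (real n) (v \<theta>)) * indicator {a..b} \<theta> \<partial>lborel) =
      ennreal (integral {a..b} (\<lambda>\<theta>. trunc_log (real n) (v \<theta>)))" for n
    by (intro bounded_borel_integrable_on(2)[OF _ bdd] trunc_log_nonneg) auto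
  have "\<infinity> = (\<integral>\<^sup>+\<theta>. (SUP n. ennreal (trunc_log (real n) (v \<theta>)) * indicator {a..b} \<theta>) \<partial>lborel)"
    unfolding inf[symmetric] using v
    by (intro nn_integral_cong) (simp add: SUP_trunc_log indicator_def)
  also have "\<dots> = (SUP n. \<integral>\<^sup>+\<theta>. ennreal (trunc_log (real n) (v \<theta>)) * indicator {a..b} \<theta> \<partial>lborel)"
    by (intro nn_integral_monotone_convergence_SUP)
      (auto simp: incseq_def le_fun_def intro!: mult_right_mono ennreal_leI trunc_log_mono)
  finally have SUP: "(SUP n. ennreal (integral {a..b} (\<lambda>\<theta>. trunc_log (real n) (v \<theta>)))) = \<infinity>"
    unfolding I by (rule sym)
  have "ennreal C < (SUP n. ennreal (integral {a..b} (\<lambda>\<theta>. trunc_log (real n) (v \<theta>))))"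
    unfolding SUP by simp
  then obtain n0 where n0: "ennreal C < ennreal (integral {a..b} (\<lambda>\<theta>. trunc_log (real n0) (v \<theta>)))"
    unfolding less_SUP_iff by blast
  have "C \<le> integral {a..b} (\<lambda>\<theta>. trunc_log (real n) (v \<theta>))" if n: "n0 \<le> n" for n
  proof -
    have "C \<le> integral {a..b} (\<lambda>\<theta>. trunc_log (real n0) (v \<theta>))"
      using n0 by (metis ennreal_leI not_less linear)
    also have "\<dots> \<le> integral {a..b} (\<lambda>\<theta>. trunc_log (real n) (v \<theta>))"
      using n by (intro integral_le bounded_borel_integrable_on(1)[OF _ bdd] trunc_log_mono) auto
    finally show ?thesis .
  qed
  then show ?thesis
    by blast
qed

text \<open>The primitive vanishes at all multiples of \<open>h\<close>, and inside a block it cannot exceed the integral of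
  \<open>\<bar>f\<bar>\<close> over the block. That integral is at most \<open>2 M h\<close>, half of it from the constant \<open>M\<close> and half
  from the other term, which has the same mean.\<close>

lemma small_primitive_if_blockwise_mean_zero:
  fixes \<kappa> :: "real \<Rightarrow> real" and c :: "int \<Rightarrow> real"
  assumes [measurable]: "\<kappa> \<in> borel_measurable borel" and \<kappa>: "\<And>\<theta>. 0 \<le> \<kappa> \<theta>" "\<And>\<theta>. \<kappa> \<theta> \<le> L"
    and h: "0 < h" and M: "0 \<le> M" and c: "\<And>j. 0 \<le> c j" "\<And>j. c j \<le> cmax"
    and mean: "\<And>j. j < N \<Longrightarrow>
      c (int j) * integral {real j * h..real (Suc j) * h} \<kappa> = M * h"
  defines "f \<equiv> \<lambda>\<theta>. c \<lfloor>\<theta> / h\<rfloor> * \<kappa> \<theta> - M"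
  assumes \<theta>: "0 \<le> \<theta>" "\<theta> \<le> real N * h"
  shows "\<bar>integral {0..\<theta>} f\<bar> \<le> 2 * M * h"
proof -
  have [measurable]: "f \<in> borel_measurable borel"
    unfolding f_def by measurable
  have cmax: "0 \<le> cmax"
    using c[of 0] by linarith
  have cl: "0 \<le> c j * \<kappa> \<theta>" "c j * \<kappa> \<theta> \<le> cmax * L" for j \<theta>
    using \<kappa> c cmax by (auto intro!: mult_mono)
  have bdd: "\<bar>f \<theta>\<bar> \<le> cmax * L + M" for \<theta>
    using cl[of "\<lfloor>\<theta> / h\<rfloor>" \<theta>] M by (simp add: f_def)
  note f_int = bounded_borel_integrable_on(1)[OF \<open>f \<in> borel_measurable borel\<close> bdd]
  have \<kappa>_int: "\<kappa> integrable_on {a..b}" for a b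
    by (rule bounded_borel_integrable_on(1)[where B = L]) (use \<kappa> in auto)
  have f_eq: "f \<theta> = c (int j) * \<kappa> \<theta> - M" if "real j * h \<le> \<theta>" "\<theta> < real (Suc j) * h" for j \<theta>
  proof -
    have "\<lfloor>\<theta> / h\<rfloor> = int j"
      using that h by (intro floor_unique) (auto simp: field_simps)
    then show ?thesis
      by (simp add: f_def)
  qed
  have c\<kappa>_int: "(\<lambda>\<theta>. x * \<kappa> \<theta>) integrable_on {a..b}" for x a b
    by (intro integrable_on_mult_right \<kappa>_int)
  have mean': "integral {real j * h..real (Suc j) * h} (\<lambda>\<theta>. c (int j) * \<kappa> \<theta> + y) = M * h + y * h"
    if j: "j < N" for j y
  proof -
    have "real (Suc j) * h - real j * h = h" "real j * h \<le> real (Suc j) * h"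
      using h by (simp_all add: algebra_simps)
    then show ?thesis
      using mean[OF j] by (subst integral_add[OF c\<kappa>_int]) (auto simp: mult.commute simp del: of_nat_Suc)
  qed
  have block: "integral {real j * h..real (Suc j) * h} f = 0" if j: "j < N" for j
  proof -
    have "integral {real j * h..real (Suc j) * h} f =
        integral {real j * h..real (Suc j) * h} (\<lambda>\<theta>. c (int j) * \<kappa> \<theta> - M)"
      by (rule integral_spike[of "{real (Suc j) * h}"]) (auto simp: f_eq)
    also have "\<dots> = 0"
      using mean'[OF j, of "- M"] by simp
    finally show ?thesis .
  qed
  have node: "integral {0..real j * h} f = 0" if "j \<le> N" for j
    using that
  proof (induction j)
    case (Suc j)
    have "integral {0..real j * h} f + integral {real j * h..real (Suc j) * h} f =
        integral {0..real (Suc j) * h} f"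
      using h f_int by (intro Henstock_Kurzweil_Integration.integral_combine) auto
    with Suc block[of j] show ?case
      by simp
  qed simp
  show ?thesis
  proof (cases "\<theta> = real N * h")
    case True
    then show ?thesis
      using node[of N] M h by simp
  next
    case False
    define j where "j = nat \<lfloor>\<theta> / h\<rfloor>"
    have j: "real j * h \<le> \<theta>" "\<theta> < real (Suc j) * h"
    proof -
      have "0 \<le> \<theta> / h"
        using \<theta> h by simp
      then have "real j \<le> \<theta> / h" "\<theta> / h < real (Suc j)"
        unfolding j_def by linarith+
      then show "real j * h \<le> \<theta>" "\<theta> < real (Suc j) * h"
        using h by (simp_all add: field_simps)
    qed
    have jN: "j < N"
    proof -
      have "real j * h < real N * h"
        using j \<theta> False by simp
      with h show ?thesis
        by simp
    qed
    have "integral {0..real j * h} f + integral {real j * h..\<theta>} f = integral {0..\<theta>} f"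
      using h f_int j by (intro Henstock_Kurzweil_Integration.integral_combine) auto
    then have "\<bar>integral {0..\<theta>} f\<bar> = \<bar>integral {real j * h..\<theta>} f\<bar>"
      using node[of j] jN by simp
    also have "\<dots> \<le> integral {real j * h..\<theta>} (\<lambda>\<theta>. c (int j) * \<kappa> \<theta> + M)"
    proof (rule Henstock_Kurzweil_Integration.integral_norm_bound_integral[of f, unfolded real_norm_def])
      show "\<bar>f x\<bar> \<le> c (int j) * \<kappa> x + M" if "x \<in> {real j * h..\<theta>}" for x
        using f_eq[of j x] cl[of "int j" x] M that j by auto
    qed (auto intro!: integrable_add c\<kappa>_int f_int)
    also have "\<dots> \<le> integral {real j * h..real (Suc j) * h} (\<lambda>\<theta>. c (int j) * \<kappa> \<theta> + M)"
      using j cl M by (intro integral_subset_le)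
        (auto intro!: integrable_add c\<kappa>_int add_nonneg_nonneg)
    also have "\<dots> = 2 * M * h"
      using mean'[OF jN, of M] by simp
    finally show ?thesis .
  qed
qed

text \<open>A single truncation level \<open>K\<close> serves all of the finitely many arcs. Once the integral of the truncated
  logarithm over an arc is at least \<open>t M h\<close>, it can be scaled down to make the mean of \<open>f\<close> zero by a
  factor \<open>c j \<le> 1 / t\<close>, and this bound on the factor keeps \<open>exp (t f) v\<close> under control.\<close>

lemma exists_boundary_function:
  fixes v :: "real \<Rightarrow> real"
  assumes [measurable]: "v \<in> borel_measurable borel" and v: "\<And>\<theta>. 0 \<le> v \<theta>"
    and inf: "\<And>a b. 0 \<le> a \<Longrightarrow> a < b \<Longrightarrow> b \<le> 2 * pi \<Longrightarrow>
      (\<integral>\<^sup>+\<theta>. e2ennreal (- eln (ennreal (v \<theta>))) * indicator {a..b} \<theta> \<partial>lborel) = \<infinity>"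
    and t: "0 < t" and M: "0 < M" and \<delta>: "0 < \<delta>"
  shows "\<exists>f B. f \<in> borel_measurable borel \<and> (\<forall>\<theta>. \<bar>f \<theta>\<bar> \<le> B) \<and>
    (\<forall>\<theta>. exp (t * f \<theta>) * v \<theta> \<le> exp (- (t * M)) * (1 + v \<theta>)) \<and>
    (\<forall>\<theta>\<in>{0..2 * pi}. \<bar>integral {0..\<theta>} f\<bar> \<le> \<delta>)"
proof -
  obtain N :: nat where N: "2 * M * (2 * pi) / \<delta> < real N"
    using reals_Archimedean2 by blast
  have N0: "0 < N"
  proof -
    have "0 < 2 * M * (2 * pi) / \<delta>"
      using M \<delta> by simp
    with N have "0 < real N"
      by linarith
    then show ?thesis
      by simp
  qed
  define h where "h = 2 * pi / real N"
  have h: "0 < h" "real N * h = 2 * pi"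
    using N0 by (auto simp: h_def)
  have Mh: "2 * M * h \<le> \<delta>"
    using N N0 \<delta> by (simp add: h_def field_simps)
  have "\<exists>n0::nat. \<forall>n\<ge>n0. t * M * h \<le>
      integral {real j * h..real (Suc j) * h} (\<lambda>\<theta>. trunc_log (real n) (v \<theta>))" if "j < N" for j
  proof (intro trunc_log_integral_large inf v)
    have "real (Suc j) * h \<le> real N * h"
      using that h by (intro mult_right_mono) auto
    then show "real (Suc j) * h \<le> 2 * pi"
      by (simp add: h)
  qed (use h in auto)
  then obtain n0 :: "nat \<Rightarrow> nat" where n0: "\<And>j n. j < N \<Longrightarrow> n0 j \<le> n \<Longrightarrow> t * M * h \<le>
      integral {real j * h..real (Suc j) * h} (\<lambda>\<theta>. trunc_log (real n) (v \<theta>))"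
    by metis
  define K where "K = Max (n0 ` {..<N})"
  define \<kappa> where "\<kappa> = (\<lambda>\<theta>. trunc_log (real K) (v \<theta>))"
  define I where "I = (\<lambda>j. integral {real j * h..real (Suc j) * h} \<kappa>)"
  have I: "t * M * h \<le> I j" if "j < N" for j
    unfolding I_def \<kappa>_def using that by (intro n0) (auto simp: K_def)
  have tMh: "0 < t * M * h"
    using t M h by simp
  define c where "c = (\<lambda>j. if nat j < N then M * h / I (nat j) else 0)"
  have c: "0 \<le> c j" "c j \<le> 1 / t" for j
  proof -
    have "0 \<le> c j \<and> c j \<le> 1 / t"
    proof (cases "nat j < N")
      case True
      have "0 < I (nat j)"
        using I[OF True] tMh by linarith
      then show ?thesis
        using True I[OF True] t M h by (simp add: c_def divide_simps) (simp add: ac_simps)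
    qed (use t in \<open>simp add: c_def\<close>)
    then show "0 \<le> c j" "c j \<le> 1 / t"
      by auto
  qed
  define f where "f = (\<lambda>\<theta>. c \<lfloor>\<theta> / h\<rfloor> * \<kappa> \<theta> - M)"
  have \<kappa>: "0 \<le> \<kappa> \<theta>" "\<kappa> \<theta> \<le> real K" for \<theta>
    by (auto simp: \<kappa>_def trunc_log_nonneg trunc_log_le)
  have [measurable]: "\<kappa> \<in> borel_measurable borel"
    unfolding \<kappa>_def by measurable
  have f_meas: "f \<in> borel_measurable borel"
    unfolding f_def by measurable
  have "\<bar>f \<theta>\<bar> \<le> 1 / t * real K + M" for \<theta>
  proof -
    have "c \<lfloor>\<theta> / h\<rfloor> * \<kappa> \<theta> \<le> 1 / t * real K" "0 \<le> c \<lfloor>\<theta> / h\<rfloor> * \<kappa> \<theta>"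
      using mult_mono[OF c(2) \<kappa>(2) _ \<kappa>(1)] c(1) \<kappa>(1) t by auto
    then show ?thesis
      using M by (simp add: f_def)
  qed
  moreover have "exp (t * f \<theta>) * v \<theta> \<le> exp (- (t * M)) * (1 + v \<theta>)" for \<theta>
  proof -
    have "exp (t * c \<lfloor>\<theta> / h\<rfloor> * trunc_log (real K) (v \<theta>)) * v \<theta> \<le> 1 + v \<theta>"
      using c[of "\<lfloor>\<theta> / h\<rfloor>"] t v by (intro exp_trunc_log_mult_le) (auto simp: field_simps)
    then have "exp (- (t * M)) * (exp (t * c \<lfloor>\<theta> / h\<rfloor> * trunc_log (real K) (v \<theta>)) * v \<theta>) \<le>
        exp (- (t * M)) * (1 + v \<theta>)"
      by (rule mult_left_mono) simp
    then show ?thesis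
      by (simp add: f_def \<kappa>_def algebra_simps exp_diff exp_minus divide_simps)
  qed
  moreover have "\<bar>integral {0..\<theta>} f\<bar> \<le> \<delta>" if \<theta>: "\<theta> \<in> {0..2 * pi}" for \<theta>
  proof -
    have "\<bar>integral {0..\<theta>} f\<bar> \<le> 2 * M * h"
      unfolding f_def
    proof (rule small_primitive_if_blockwise_mean_zero[where N = N and cmax = "1 / t" and L = "real K"])
      show "c (int j) * integral {real j * h..real (Suc j) * h} \<kappa> = M * h" if "j < N" for j
        using I[OF that] tMh that by (simp add: c_def I_def)
    qed (use \<theta> h M c \<kappa> in auto)
    with Mh show ?thesis
      by simp
  qed
  ultimately show ?thesis
    using f_meas by (intro exI[of _ f] exI[of _ "1 / t * real K + M"]) blast
qed

section \<open>Polynomials that are small in the disk\<close>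

text \<open>Lets an \<open>L\<^sup>1\<close> estimate of exponents that are bounded above pass to the exponentials.\<close>

lemma exp_le_exp_plus:
  fixes x y b :: real
  assumes "x \<le> b"
  shows "exp x \<le> exp y + exp b * \<bar>x - y\<bar>"
proof (cases "x \<le> y")
  case True
  then have "exp x \<le> exp y"
    by simp
  also have "\<dots> \<le> exp y + exp b * \<bar>x - y\<bar>"
    by simp
  finally show ?thesis .
next
  case False
  have "exp x * (1 + (y - x)) \<le> exp x * exp (y - x)"
    by (intro mult_left_mono exp_ge_add_one_self) auto
  also have "\<dots> = exp y"
    by (simp flip: exp_add)
  finally have "exp x \<le> exp y + exp x * (x - y)"
    by (simp add: algebra_simps)
  also have "exp x * (x - y) \<le> exp b * (x - y)"
    using assms False by (intro mult_right_mono) auto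
  finally show ?thesis
    using False by simp
qed

text \<open>The boundary function on \<open>[0, 2 \<pi>]\<close> is transplanted to the circle and approximated there by \<open>Re q0\<close> in
  \<open>L\<^sup>1\<close> with respect to \<open>1 + W\<close>: the summand \<open>1\<close> controls the change of the primitive and the summand
  \<open>W\<close> the change of the integral of \<open>exp (t Re q) W\<close>. Subtraction of the constant \<open>q0(0)\<close> changes the
  real part by little, because the boundary function has nearly mean zero.\<close>

lemma poly_small_on_circle_and_disk:
  fixes W :: "complex \<Rightarrow> real"
  assumes [measurable]: "W \<in> borel_measurable borel" and W: "\<And>z. 0 \<le> W z"
    and fin: "(\<integral>\<^sup>+z. ennreal (W z) \<partial>circle_measure) < \<infinity>"
    and inf: "\<And>a b. 0 \<le> a \<Longrightarrow> a < b \<Longrightarrow> b \<le> 2 * pi \<Longrightarrow>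
      (\<integral>\<^sup>+\<theta>. e2ennreal (- eln (ennreal (W (cis \<theta>)))) * indicator {a..b} \<theta> \<partial>lborel) = \<infinity>"
    and t: "0 < t" and \<epsilon>: "0 < \<epsilon>"
  shows "\<exists>q. poly q 0 = 0 \<and>
    (\<integral>\<^sup>+z. ennreal (exp (t * Re (poly q z)) * W z) \<partial>circle_measure) < ennreal \<epsilon> \<and>
    (\<forall>z. cmod z < 1 \<longrightarrow> cmod (poly q z) \<le> \<epsilon> / (1 - cmod z))"
proof -
  interpret circle: finite_measure circle_measure
    by (rule finite_circle_measure)
  have "(\<integral>\<^sup>+z. ennreal (1 + W z) \<partial>circle_measure) =
      (\<integral>\<^sup>+z. 1 + ennreal (W z) \<partial>circle_measure)"
    using W by simp
  also have "\<dots> = emeasure circle_measure UNIV + (\<integral>\<^sup>+z. ennreal (W z) \<partial>circle_measure)"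
    by (subst nn_integral_add) auto
  also have "\<dots> < \<infinity>"
    using fin by (simp add: circle.emeasure_eq_measure)
  finally obtain s where s: "0 \<le> s" "(\<integral>\<^sup>+z. ennreal (1 + W z) \<partial>circle_measure) = ennreal s"
    by (metis ennreal_cases infinity_ennreal_def less_irrefl)
  \<comment> \<open>large enough for \<open>exp (- (t * M)) * s \<le> \<epsilon> / 4\<close>\<close>
  define M where "M = max 1 (ln (4 * (s + 1) / \<epsilon>) / t)"
  have M: "0 < M"
    by (simp add: M_def)
  have Ms: "exp (- (t * M)) * s \<le> \<epsilon> / 4"
  proof -
    have "ln (4 * (s + 1) / \<epsilon>) / t \<le> M"
      by (simp add: M_def)
    then have "- (t * M) \<le> - ln (4 * (s + 1) / \<epsilon>)"
      using t by (simp add: field_simps)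
    then have "exp (- (t * M)) \<le> exp (- ln (4 * (s + 1) / \<epsilon>))"
      by simp
    also have "\<dots> = \<epsilon> / (4 * (s + 1))"
      using s \<epsilon> by (subst exp_minus, subst exp_ln) (auto simp: add_nonneg_pos)
    finally have "exp (- (t * M)) * s \<le> \<epsilon> / (4 * (s + 1)) * s"
      using s by (intro mult_right_mono) auto
    also have "\<dots> \<le> \<epsilon> / 4"
      using s \<epsilon> by (simp add: field_simps)
    finally show ?thesis .
  qed
  \<comment> \<open>half of the budget \<open>ln 2\<close> for the constant \<open>t * r\<close> below goes to \<open>\<delta>\<close>, half to \<open>\<eta>\<close>\<close>
  define \<delta> where "\<delta> = min (\<epsilon> / 8) (ln 2 / (2 * t))"
  have \<delta>: "0 < \<delta>" "\<delta> \<le> \<epsilon> / 8" "t * \<delta> \<le> ln 2 / 2"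
    using \<epsilon> t by (auto simp: \<delta>_def min_def field_simps)
  have "\<exists>f B. f \<in> borel_measurable borel \<and> (\<forall>\<theta>. \<bar>f \<theta>\<bar> \<le> B) \<and>
      (\<forall>\<theta>. exp (t * f \<theta>) * W (cis \<theta>) \<le> exp (- (t * M)) * (1 + W (cis \<theta>))) \<and>
      (\<forall>\<theta>\<in>{0..2 * pi}. \<bar>integral {0..\<theta>} f\<bar> \<le> \<delta>)"
    by (rule exists_boundary_function) (use W inf t M \<delta> in auto)
  then obtain f B where f [measurable]: "f \<in> borel_measurable borel" and B: "\<And>\<theta>. \<bar>f \<theta>\<bar> \<le> B"
    and fW: "\<And>\<theta>. exp (t * f \<theta>) * W (cis \<theta>) \<le> exp (- (t * M)) * (1 + W (cis \<theta>))"
    and f\<delta>: "\<And>\<theta>. \<theta> \<in> {0..2 * pi} \<Longrightarrow> \<bar>integral {0..\<theta>} f\<bar> \<le> \<delta>"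
    by blast
  define \<phi> where "\<phi> = (\<lambda>z. f (Arg2pi z))"
  have [measurable]: "\<phi> \<in> borel_measurable borel"
    unfolding \<phi>_def by measurable
  have \<phi>W: "exp (t * \<phi> z) * W z \<le> exp (- (t * M)) * (1 + W z)" if "cmod z = 1" for z
    using fW[of "Arg2pi z"] Arg2pi_eq[of z] that by (simp add: \<phi>_def cis_conv_exp)
  \<comment> \<open>a Lipschitz constant of \<open>\<lambda>x. exp (t * x)\<close> on the range of \<open>\<phi>\<close> and of \<open>Re q0\<close>\<close>
  define b where "b = t * exp (t * (B + 1))"
  have b: "0 < b"
    using t by (simp add: b_def)
  define \<eta> where "\<eta> = min (ln 2 / (2 * t)) (min (\<epsilon> / (8 * b)) (\<epsilon> / (16 * pi)))"
  have \<eta>: "0 < \<eta>" "t * \<eta> \<le> ln 2 / 2" "b * \<eta> \<le> \<epsilon> / 8" "4 * pi * \<eta> \<le> \<epsilon> / 4"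
  proof -
    show "0 < \<eta>"
      using \<epsilon> t b by (simp add: \<eta>_def)
    have "\<eta> \<le> ln 2 / (2 * t)" "\<eta> \<le> \<epsilon> / (8 * b)" "\<eta> \<le> \<epsilon> / (16 * pi)"
      by (auto simp: \<eta>_def)
    then show "t * \<eta> \<le> ln 2 / 2" "b * \<eta> \<le> \<epsilon> / 8" "4 * pi * \<eta> \<le> \<epsilon> / 4"
      using t b by (simp_all add: field_simps)
  qed
  define \<nu> where "\<nu> = density circle_measure (\<lambda>z. ennreal (1 + W z))"
  have "finite_measure \<nu>"
    by (rule finite_measureI) (simp add: \<nu>_def emeasure_density s(2))
  moreover have "sets \<nu> = sets borel"
    by (simp add: \<nu>_def)
  moreover have "AE z in \<nu>. cmod z = 1"
    unfolding \<nu>_def using AE_circle_measure by (subst AE_density) (auto elim!: eventually_mono)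
  moreover have "\<bar>\<phi> z\<bar> \<le> B" for z
    by (simp add: \<phi>_def B)
  ultimately have "\<exists>q. (\<forall>z\<in>sphere 0 1. \<bar>Re (poly q z)\<bar> \<le> B + 1) \<and>
      (\<integral>\<^sup>+z. ennreal \<bar>\<phi> z - Re (poly q z)\<bar> \<partial>\<nu>) < ennreal \<eta>"
    using \<eta>(1) by (intro bounded_approx_Re_poly) auto
  then obtain q0 where "\<forall>z\<in>sphere 0 1. \<bar>Re (poly q0 z)\<bar> \<le> B + 1"
    and q0_\<nu>: "(\<integral>\<^sup>+z. ennreal \<bar>\<phi> z - Re (poly q0 z)\<bar> \<partial>\<nu>) < ennreal \<eta>"
    by blast
  then have q0_le: "\<And>z. cmod z = 1 \<Longrightarrow> \<bar>Re (poly q0 z)\<bar> \<le> B + 1"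
    by simp
  have \<nu>_eq: "(\<integral>\<^sup>+z. ennreal \<bar>\<phi> z - Re (poly q0 z)\<bar> \<partial>\<nu>) =
      (\<integral>\<^sup>+z. ennreal (1 + W z) * ennreal \<bar>\<phi> z - Re (poly q0 z)\<bar> \<partial>circle_measure)"
    unfolding \<nu>_def by (intro nn_integral_density) auto
  have D1: "(\<integral>\<^sup>+z. ennreal \<bar>\<phi> z - Re (poly q0 z)\<bar> \<partial>circle_measure) < ennreal \<eta>"
  proof (rule le_less_trans[OF _ q0_\<nu>[unfolded \<nu>_eq]], rule nn_integral_mono)
    fix z
    have "1 * ennreal \<bar>\<phi> z - Re (poly q0 z)\<bar> \<le> ennreal (1 + W z) * ennreal \<bar>\<phi> z - Re (poly q0 z)\<bar>"
      using W by (intro mult_right_mono) auto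
    then show "ennreal \<bar>\<phi> z - Re (poly q0 z)\<bar> \<le> ennreal (1 + W z) * ennreal \<bar>\<phi> z - Re (poly q0 z)\<bar>"
      by simp
  qed
  have D2: "(\<integral>\<^sup>+z. ennreal (W z * \<bar>\<phi> z - Re (poly q0 z)\<bar>) \<partial>circle_measure) < ennreal \<eta>"
  proof (rule le_less_trans[OF _ q0_\<nu>[unfolded \<nu>_eq]], rule nn_integral_mono)
    fix z
    show "ennreal (W z * \<bar>\<phi> z - Re (poly q0 z)\<bar>) \<le>
        ennreal (1 + W z) * ennreal \<bar>\<phi> z - Re (poly q0 z)\<bar>"
      using W[of z] by (subst ennreal_mult[symmetric]) (auto intro!: ennreal_leI mult_right_mono)
  qed
  define g where "g = (\<lambda>\<theta>. f \<theta> - Re (poly q0 (cis \<theta>)))"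
  have [measurable]: "g \<in> borel_measurable borel"
    unfolding g_def by measurable
  have g_bdd: "\<bar>g \<theta>\<bar> \<le> 2 * B + 1" for \<theta>
    using B[of \<theta>] q0_le[of "cis \<theta>"] by (simp add: g_def)
  then have abs_g_bdd: "\<bar>\<bar>g \<theta>\<bar>\<bar> \<le> 2 * B + 1" for \<theta>
    by simp
  have f_int: "f integrable_on {c..d}" and g_int: "g integrable_on {c..d}"
    and abs_g_int: "(\<lambda>\<theta>. \<bar>g \<theta>\<bar>) integrable_on {c..d}" for c d
    by (rule bounded_borel_integrable_on(1)[OF _ B] bounded_borel_integrable_on(1)[OF _ g_bdd]
        bounded_borel_integrable_on(1)[OF _ abs_g_bdd]; measurable)+
  have g_small: "integral {0..2 * pi} (\<lambda>\<theta>. \<bar>g \<theta>\<bar>) \<le> 2 * pi * \<eta>"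
  proof -
    have "(\<integral>\<^sup>+z. ennreal \<bar>\<phi> z - Re (poly q0 z)\<bar> \<partial>circle_measure) =
        ennreal (1 / (2 * pi)) * (\<integral>\<^sup>+\<theta>. ennreal \<bar>\<phi> (cis \<theta>) - Re (poly q0 (cis \<theta>))\<bar> *
          indicator {0..2 * pi} \<theta> \<partial>lborel)"
      by (subst nn_integral_circle_measure) auto
    also have "(\<integral>\<^sup>+\<theta>. ennreal \<bar>\<phi> (cis \<theta>) - Re (poly q0 (cis \<theta>))\<bar> * indicator {0..2 * pi} \<theta> \<partial>lborel) =
        (\<integral>\<^sup>+\<theta>. ennreal \<bar>g \<theta>\<bar> * indicator {0..2 * pi} \<theta> \<partial>lborel)"
      using AE_lborel_singleton[of "2 * pi"]
      by (intro nn_integral_cong_AE)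
        (auto simp: indicator_def g_def \<phi>_def Arg2pi_cis elim!: eventually_mono)
    also have "\<dots> = ennreal (integral {0..2 * pi} (\<lambda>\<theta>. \<bar>g \<theta>\<bar>))"
      by (intro bounded_borel_integrable_on(2)[OF _ abs_g_bdd]) auto
    also have "ennreal (1 / (2 * pi)) * \<dots> = ennreal (1 / (2 * pi) * integral {0..2 * pi} (\<lambda>\<theta>. \<bar>g \<theta>\<bar>))"
      by (rule ennreal_mult'[symmetric]) simp
    finally have "1 / (2 * pi) * integral {0..2 * pi} (\<lambda>\<theta>. \<bar>g \<theta>\<bar>) < \<eta>"
      using D1 \<eta>(1) by (metis ennreal_leI not_less)
    then show ?thesis
      by (simp add: field_simps)
  qed
  have g_primitive: "\<bar>integral {0..\<theta>} g\<bar> \<le> 2 * pi * \<eta>" if "\<theta> \<in> {0..2 * pi}" for \<theta>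
  proof -
    have "\<bar>integral {0..\<theta>} g\<bar> \<le> integral {0..\<theta>} (\<lambda>\<theta>. \<bar>g \<theta>\<bar>)"
      by (rule Henstock_Kurzweil_Integration.integral_norm_bound_integral[of g, unfolded real_norm_def])
        (auto intro: g_int abs_g_int)
    also have "\<dots> \<le> integral {0..2 * pi} (\<lambda>\<theta>. \<bar>g \<theta>\<bar>)"
      using that by (intro integral_subset_le abs_g_int) auto
    finally show ?thesis
      using g_small by simp
  qed
  have Re_q0_int: "integral {0..\<theta>} (\<lambda>s. Re (poly q0 (cis s))) = integral {0..\<theta>} f - integral {0..\<theta>} g" for \<theta>
    by (subst integral_diff[symmetric, OF f_int g_int]) (simp add: g_def)
  define r where "r = Re (poly q0 0)"
  have r: "2 * pi * \<bar>r\<bar> \<le> \<delta> + 2 * pi * \<eta>"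
  proof -
    have "2 * pi * r = integral {0..2 * pi} f - integral {0..2 * pi} g"
      using integral_unique[OF integral_cis_Re_poly[of q0]] Re_q0_int by (simp add: r_def)
    then have "\<bar>2 * pi * r\<bar> \<le> \<delta> + 2 * pi * \<eta>"
      using f\<delta>[of "2 * pi"] g_primitive[of "2 * pi"] by simp
    then show ?thesis
      by (simp add: abs_mult)
  qed
  have r': "\<bar>r\<bar> \<le> \<delta> + \<eta>"
  proof -
    have "2 * pi * \<bar>r\<bar> \<le> 2 * pi * (\<delta> + \<eta>)"
      using r \<delta>(1) pi_ge_two mult_right_mono[of 1 "2 * pi" \<delta>] unfolding distrib_left by linarith
    then show ?thesis
      by simp
  qed
  define q where "q = q0 - [:poly q0 0:]"
  have Re_q: "Re (poly q z) = Re (poly q0 z) - r" for z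
    by (simp add: q_def r_def)
  have q_0: "poly q 0 = 0"
    by (simp add: q_def)
  have q_growth: "cmod (poly q z) \<le> \<epsilon> / (1 - cmod z)" if z: "cmod z < 1" for z
  proof -
    have "cmod (poly q z) \<le> 2 * (\<epsilon> / 2) / (1 - cmod z)"
    proof (rule poly_bound_by_primitive_of_Re[OF z q_0])
      fix \<theta> :: real assume \<theta>: "\<theta> \<in> {0..2 * pi}"
      have "integral {0..\<theta>} (\<lambda>s. Re (poly q (cis s))) =
          integral {0..\<theta>} (\<lambda>s. Re (poly q0 (cis s))) - \<theta> * r"
        unfolding Re_q using \<theta>
        by (subst integral_diff) (auto intro!: integrable_continuous_interval continuous_intros)
      moreover have "\<bar>\<theta> * r\<bar> \<le> 2 * pi * \<bar>r\<bar>"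
        using \<theta> by (simp add: abs_mult mult_right_mono)
      ultimately show "\<bar>integral {0..\<theta>} (\<lambda>s. Re (poly q (cis s)))\<bar> \<le> \<epsilon> / 2"
        using Re_q0_int[of \<theta>] f\<delta>[OF \<theta>] g_primitive[OF \<theta>] r \<delta>(2) \<eta>(4) by linarith
    qed
    then show ?thesis
      by simp
  qed
  have "(\<integral>\<^sup>+z. ennreal (exp (t * Re (poly q z)) * W z) \<partial>circle_measure) \<le>
      (\<integral>\<^sup>+z. ennreal (2 * exp (- (t * M))) * ennreal (1 + W z) +
        ennreal (2 * b) * ennreal (W z * \<bar>\<phi> z - Re (poly q0 z)\<bar>) \<partial>circle_measure)"
  proof (rule nn_integral_mono_AE)
    show "AE z in circle_measure. ennreal (exp (t * Re (poly q z)) * W z) \<le>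
        ennreal (2 * exp (- (t * M))) * ennreal (1 + W z) +
        ennreal (2 * b) * ennreal (W z * \<bar>\<phi> z - Re (poly q0 z)\<bar>)"
      using AE_circle_measure
    proof eventually_elim
      case (elim z)
      have "exp (t * Re (poly q z)) = exp (- (t * r)) * exp (t * Re (poly q0 z))"
        by (simp add: Re_q right_diff_distrib flip: exp_add)
      also have "\<dots> \<le> 2 * (exp (t * \<phi> z) + b * \<bar>\<phi> z - Re (poly q0 z)\<bar>)"
      proof (rule mult_mono)
        have "- (t * r) \<le> t * (\<delta> + \<eta>)"
          using r' t mult_left_mono[of "- r" "\<delta> + \<eta>" t] by simp
        also have "\<dots> \<le> ln 2"
          using \<delta>(3) \<eta>(2) by (simp add: distrib_left)
        finally have "exp (- (t * r)) \<le> exp (ln 2)"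
          by (simp only: exp_le_cancel_iff)
        then show "exp (- (t * r)) \<le> 2"
          by simp
        have "t * Re (poly q0 z) \<le> t * (B + 1)"
          using q0_le[OF elim] t by (intro mult_left_mono) auto
        from exp_le_exp_plus[OF this, of "t * \<phi> z"]
        have "exp (t * Re (poly q0 z)) \<le>
            exp (t * \<phi> z) + exp (t * (B + 1)) * \<bar>t * Re (poly q0 z) - t * \<phi> z\<bar>" .
        also have "\<bar>t * Re (poly q0 z) - t * \<phi> z\<bar> = t * \<bar>\<phi> z - Re (poly q0 z)\<bar>"
          unfolding right_diff_distrib[symmetric] abs_mult using t by (simp add: abs_minus_commute)
        finally show "exp (t * Re (poly q0 z)) \<le> exp (t * \<phi> z) + b * \<bar>\<phi> z - Re (poly q0 z)\<bar>"
          unfolding b_def by (simp only: ac_simps)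
      qed auto
      finally have "exp (t * Re (poly q z)) * W z \<le>
          2 * (exp (t * \<phi> z) + b * \<bar>\<phi> z - Re (poly q0 z)\<bar>) * W z"
        using W by (rule mult_right_mono)
      also have "\<dots> = 2 * (exp (t * \<phi> z) * W z) + 2 * b * (W z * \<bar>\<phi> z - Re (poly q0 z)\<bar>)"
        by (simp add: algebra_simps)
      also have "\<dots> \<le> 2 * exp (- (t * M)) * (1 + W z) + 2 * b * (W z * \<bar>\<phi> z - Re (poly q0 z)\<bar>)"
        using \<phi>W[OF elim] by simp
      finally have "ennreal (exp (t * Re (poly q z)) * W z) \<le>
          ennreal (2 * exp (- (t * M)) * (1 + W z) + 2 * b * (W z * \<bar>\<phi> z - Re (poly q0 z)\<bar>))"
        by (rule ennreal_leI)
      also have "\<dots> = ennreal (2 * exp (- (t * M))) * ennreal (1 + W z) +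
          ennreal (2 * b) * ennreal (W z * \<bar>\<phi> z - Re (poly q0 z)\<bar>)"
        using W[of z] b by (subst ennreal_plus) (auto simp: ennreal_mult)
      finally show ?case .
    qed
  qed
  also have "\<dots> = ennreal (2 * exp (- (t * M))) * (\<integral>\<^sup>+z. ennreal (1 + W z) \<partial>circle_measure) +
      ennreal (2 * b) * (\<integral>\<^sup>+z. ennreal (W z * \<bar>\<phi> z - Re (poly q0 z)\<bar>) \<partial>circle_measure)"
    by (subst nn_integral_add) (auto simp: nn_integral_cmult simp del: ennreal_plus)
  also have "\<dots> \<le> ennreal (2 * exp (- (t * M))) * ennreal s + ennreal (2 * b) * ennreal \<eta>"
    unfolding s(2) using D2 by (intro add_mono mult_left_mono) auto
  also have "\<dots> = ennreal (2 * (exp (- (t * M)) * s) + 2 * (b * \<eta>))"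
    using s(1) b \<eta>(1) by (simp add: ennreal_mult ennreal_plus mult.assoc)
  also have "\<dots> < ennreal \<epsilon>"
    using Ms \<eta>(3) \<epsilon> by (intro ennreal_lessI) auto
  finally show ?thesis
    using q_0 q_growth by (intro exI[of _ q]) blast
qed

section \<open>The area part\<close>

text \<open>Any \<open>c\<close> strictly between \<open>0\<close> and the lower limit works.\<close>

lemma decay_of_Liminf:
  assumes "Liminf (at_right 0) (\<lambda>x. ereal x * eln (1 / ennreal (G x))) > 0"
  shows "\<exists>c>0. \<exists>x0>0. \<forall>x. 0 < x \<and> x < x0 \<longrightarrow> G x \<le> exp (- c / x)"
proof -
  from ereal_dense2[OF assms] obtain c where c: "0 < ereal c"
      "ereal c < Liminf (at_right 0) (\<lambda>x. ereal x * eln (1 / ennreal (G x)))"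
    by blast
  from less_LiminfD[OF c(2)] obtain x0 where x0: "0 < x0"
      "\<And>x. 0 < x \<Longrightarrow> x < x0 \<Longrightarrow> ereal c < ereal x * eln (1 / ennreal (G x))"
    unfolding eventually_at_right_field by auto
  have "G x \<le> exp (- c / x)" if x: "0 < x" "x < x0" for x
  proof (cases "G x \<le> 0")
    case True
    then show ?thesis
      by (rule order.trans) simp
  next
    case False
    then have "1 / ennreal (G x) = ennreal (1 / G x)"
      by (simp add: divide_ennreal flip: ennreal_1)
    then have "eln (1 / ennreal (G x)) = ereal (- ln (G x))"
      using False by (simp add: eln_def ln_div)
    with x0(2)[OF x] have "c < x * - ln (G x)"
      by simp
    then have "ln (G x) \<le> - c / x"
      using x by (simp add: field_simps)
    then show ?thesis
      using False by (metis exp_le_cancel_iff exp_ln linorder_not_le)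
  qed
  with c(1) x0(1) show ?thesis
    by auto
qed

lemma sets_area_measure [simp, measurable_cong]: "sets area_measure = sets borel"
  and space_area_measure [simp]: "space area_measure = UNIV"
  by (simp_all add: area_measure_def space_scale_measure)

lemma emeasure_area_ball: "emeasure area_measure (ball 0 1) < \<infinity>"
  using emeasure_lborel_ball_finite[of "0::complex" 1]
  by (simp add: area_measure_def ennreal_mult_less_top)

lemma borel_measurable_disk_weight:
  fixes G :: "real \<Rightarrow> real"
  assumes "mono_on {0..1} G"
  shows "(\<lambda>z::complex. indicator (ball 0 1) z * G (1 - cmod z)) \<in> borel_measurable borel"
proof -
  have "G \<in> borel_measurable (restrict_space borel {0..1})"
    using assms by (rule borel_measurable_mono_on_fnc)
  then have [measurable]: "(\<lambda>x. indicator {0..1} x *\<^sub>R G x) \<in> borel_measurable borel"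
    by (subst (asm) borel_measurable_restrict_space_iff) auto
  have "(\<lambda>z::complex. indicator (ball 0 1) z *
      (indicator {0..1} (1 - cmod z) *\<^sub>R G (1 - cmod z))) \<in> borel_measurable borel"
    by (intro borel_measurable_times borel_measurable_indicator
        measurable_compose[of "\<lambda>z. 1 - cmod z" borel borel "\<lambda>x. indicator {0..1} x *\<^sub>R G x"]) measurable
  also have "(\<lambda>z::complex. indicator (ball 0 1) z * (indicator {0..1} (1 - cmod z) *\<^sub>R G (1 - cmod z))) =
      (\<lambda>z. indicator (ball 0 1) z * G (1 - cmod z))"
    by (auto simp: indicator_def)
  finally show ?thesis .
qed

lemma sets_disk_part [simp, measurable_cong]: "sets (disk_part G) = sets borel"
  by (simp add: disk_part_def)

lemma AE_disk_part:
  assumes "mono_on {0..1} G"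
  shows "AE z in disk_part G. cmod z < 1"
  unfolding disk_part_def using borel_measurable_disk_weight[OF assms]
  by (subst AE_density) (auto simp: indicator_def)

lemma closed_disk_measure_disk_part:
  assumes G: "mono_on {0..1} G" and G1: "\<And>x. x \<in> {0..1} \<Longrightarrow> G x \<in> {0..<1}"
  shows "closed_disk_measure (disk_part G)"
proof -
  have [measurable]: "(\<lambda>z::complex. indicator (ball 0 1) z * G (1 - cmod z)) \<in> borel_measurable borel"
    by (rule borel_measurable_disk_weight[OF G])
  have "emeasure (disk_part G) (space (disk_part G)) =
      (\<integral>\<^sup>+z. ennreal (indicator (ball 0 1) z * G (1 - cmod z)) \<partial>area_measure)"
    unfolding disk_part_def by (subst emeasure_density) (auto intro!: nn_integral_cong)
  also have "\<dots> \<le> (\<integral>\<^sup>+z. indicator (ball 0 1) z \<partial>area_measure)"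
  proof (rule nn_integral_mono)
    fix z :: complex
    show "ennreal (indicator (ball 0 1) z * G (1 - cmod z)) \<le> indicator (ball 0 1) z"
      using G1[of "1 - cmod z"] by (auto simp: indicator_def)
  qed
  also have "\<dots> < \<infinity>"
    using emeasure_area_ball by simp
  finally have "finite_measure (disk_part G)"
    by (intro finite_measureI) auto
  then show ?thesis
    unfolding closed_disk_measure_def closed_disk_measure_axioms_def
    using AE_disk_part[OF G] by (auto elim: eventually_mono)
qed

text \<open>The integrand dominates \<open>\<bar>exp q - 1\<bar>\<^sup>t\<close> if \<open>\<bar>q(z)\<bar> \<le> \<delta> / (1 - \<bar>z\<bar>)\<close>. It tends to \<open>0\<close> pointwise as \<open>\<delta>\<close>
  tends to \<open>0\<close>, and because of \<open>u \<le> exp u\<close> it is at most \<open>exp (2 t \<delta> / (1 - \<bar>z\<bar>))\<close>, so that \<open>G\<close>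
  compensates it near the circle as soon as \<open>2 t \<delta> \<le> c\<close>.\<close>

lemma growth_integral_small:
  assumes G: "mono_on {0..1} G" and G1: "\<And>x. x \<in> {0..1} \<Longrightarrow> G x \<in> {0..<1}"
    and c: "0 < c" and x0: "0 < x0" and decay: "\<And>x. 0 < x \<Longrightarrow> x < x0 \<Longrightarrow> G x \<le> exp (- c / x)"
    and t: "0 < t" and e: "0 < e"
  shows "\<exists>\<delta>>0. (\<integral>\<^sup>+z. ennreal ((\<delta> / (1 - cmod z) * exp (\<delta> / (1 - cmod z))) powr t) \<partial>disk_part G)
    < ennreal e"
proof -
  define g where "g = (\<lambda>z::complex. indicator (ball 0 1) z * G (1 - cmod z))"
  have [measurable]: "g \<in> borel_measurable borel"
    unfolding g_def by (rule borel_measurable_disk_weight[OF G])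
  have [measurable]: "ball (0::complex) 1 \<in> sets borel"
    by simp
  \<comment> \<open>the start value makes \<open>exp (2 * t * d n / x)\<close> at most \<open>exp (c / x)\<close>\<close>
  define d where "d = (\<lambda>n. c / (2 * t) / real (Suc n))"
  have d: "0 < d n" "2 * t * d n \<le> c" for n
  proof -
    show "0 < d n"
      using c t by (simp add: d_def)
    have "2 * t * d n = c / real (Suc n)"
      using t by (simp add: d_def)
    also have "\<dots> \<le> c / 1"
      using c by (intro divide_left_mono) auto
    finally show "2 * t * d n \<le> c"
      by simp
  qed
  have d_lim: "d \<longlonglongrightarrow> 0"
    unfolding d_def by (rule LIMSEQ_Suc[OF lim_const_over_n])
  define u where "u = (\<lambda>n z. (d n / (1 - cmod z) * exp (d n / (1 - cmod z))) powr t)"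
  have [measurable]: "u n \<in> borel_measurable borel" for n
    unfolding u_def by measurable
  have "(\<lambda>n. \<integral>\<^sup>+z. ennreal (g z) * ennreal (u n z) \<partial>area_measure) \<longlonglongrightarrow> (\<integral>\<^sup>+z. 0 \<partial>area_measure)"
  proof (rule nn_integral_dominated_convergence)
    show "(\<integral>\<^sup>+z. ennreal (exp (c / x0)) * indicator (ball 0 1) z \<partial>area_measure) < \<infinity>"
      using emeasure_area_ball by (subst nn_integral_cmult_indicator) (auto simp: ennreal_mult_less_top)
    show "AE z in area_measure. ennreal (g z) * ennreal (u n z) \<le>
        ennreal (exp (c / x0)) * indicator (ball 0 1) z" for n
    proof (intro AE_I2)
      fix z :: complex
      show "ennreal (g z) * ennreal (u n z) \<le> ennreal (exp (c / x0)) * indicator (ball 0 1) z"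
      proof (cases "cmod z < 1")
        case True
        define x where "x = 1 - cmod z"
        have x: "0 < x" "x \<le> 1"
          using True by (auto simp: x_def)
        have "d n / x * exp (d n / x) \<le> exp (d n / x) * exp (d n / x)"
        proof (rule mult_right_mono)
          show "d n / x \<le> exp (d n / x)"
            using exp_ge_add_one_self[of "d n / x"] by linarith
        qed simp
        then have "u n z \<le> (exp (d n / x) * exp (d n / x)) powr t"
          using d[of n] x t unfolding u_def x_def[symmetric] by (intro powr_mono2) auto
        also have "\<dots> = exp (2 * t * d n / x)"
          by (simp add: powr_def field_simps flip: exp_add)
        also have "\<dots> \<le> exp (c / x)"
          using d[of n] x by (simp add: divide_right_mono)
        finally have u: "u n z \<le> exp (c / x)" .
        have Gx: "0 \<le> G x" "G x < 1"
          using G1[of x] x by auto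
        have "G x * u n z \<le> exp (c / x0)"
        proof (cases "x < x0")
          case True
          have "G x * u n z \<le> exp (- c / x) * exp (c / x)"
            using decay[OF x(1) True] u Gx by (intro mult_mono) (auto simp: u_def)
          also have "\<dots> = 1"
            by (simp flip: exp_add)
          also have "1 \<le> exp (c / x0)"
            using c x0 by simp
          finally show ?thesis .
        next
          case False
          have "G x * u n z \<le> 1 * exp (c / x)"
            using u Gx by (intro mult_mono) (auto simp: u_def)
          also have "\<dots> \<le> exp (c / x0)"
            using False c x0 by (simp add: frac_le)
          finally show ?thesis .
        qed
        then show ?thesis
          using True Gx by (simp add: g_def x_def indicator_def ennreal_leI u_def flip: ennreal_mult)
      qed (simp add: g_def indicator_def)
    qed
    show "AE z in area_measure. (\<lambda>n. ennreal (g z) * ennreal (u n z)) \<longlonglongrightarrow> 0"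
    proof (intro AE_I2)
      fix z :: complex
      have "(\<lambda>n. d n / (1 - cmod z)) \<longlonglongrightarrow> 0 / (1 - cmod z)" if "cmod z < 1"
        using that by (intro tendsto_divide d_lim tendsto_const) auto
      then have "(\<lambda>n. d n / (1 - cmod z) * exp (d n / (1 - cmod z))) \<longlonglongrightarrow> 0 * exp 0" if "cmod z < 1"
        using that by (intro tendsto_mult tendsto_exp) auto
      then have "(\<lambda>n. u n z) \<longlonglongrightarrow> 0 powr t" if "cmod z < 1"
        unfolding u_def using that t d
        by (intro tendsto_powr') (auto simp: less_imp_le intro!: always_eventually)
      then have "(\<lambda>n. g z * u n z) \<longlonglongrightarrow> 0"
        by (cases "cmod z < 1") (auto simp: g_def indicator_def intro!: tendsto_mult_right_zero)
      moreover have "0 \<le> g z"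
        using G1[of "1 - cmod z"] by (auto simp: g_def indicator_def)
      moreover have "0 \<le> u n z" for n
        by (simp add: u_def)
      ultimately show "(\<lambda>n. ennreal (g z) * ennreal (u n z)) \<longlonglongrightarrow> 0"
        using tendsto_ennrealI[of "\<lambda>n. g z * u n z" 0] by (simp add: ennreal_mult)
    qed
  qed measurable
  moreover have "(\<integral>\<^sup>+z. ennreal (u n z) \<partial>disk_part G) =
      (\<integral>\<^sup>+z. ennreal (g z) * ennreal (u n z) \<partial>area_measure)" for n
    unfolding disk_part_def g_def
    by (intro nn_integral_density) (use borel_measurable_disk_weight[OF G] in measurable)
  ultimately have "(\<lambda>n. \<integral>\<^sup>+z. ennreal (u n z) \<partial>disk_part G) \<longlonglongrightarrow> 0"
    by simp
  from order_tendstoD(2)[OF this, of "ennreal e"] e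
  obtain n where "(\<integral>\<^sup>+z. ennreal (u n z) \<partial>disk_part G) < ennreal e"
    by (auto simp: eventually_sequentially)
  then show ?thesis
    using d(1)[of n] by (intro exI[of _ "d n"]) (auto simp: u_def)
qed

section \<open>Separating polynomials\<close>

text \<open>The partial sums of the exponential series, evaluated at \<open>q\<close>.\<close>

lemma exp_poly_uniform_approx:
  assumes q: "poly q 0 = 0" and \<eta>: "0 < \<eta>"
  shows "\<exists>F :: complex poly. poly F 0 = 1 \<and>
    (\<forall>z. cmod z \<le> 1 \<longrightarrow> cmod (poly F z - exp (poly q z)) \<le> \<eta>)"
proof -
  have "compact (poly q ` cball 0 1)"
    by (intro compact_continuous_image continuous_intros) auto
  then obtain R where R: "0 < R" "\<forall>w\<in>poly q ` cball 0 1. cmod w \<le> R"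
    using compact_imp_bounded[of "poly q ` cball 0 1"] by (auto simp: bounded_pos)
  then have R': "cmod (poly q z) \<le> R" if "cmod z \<le> 1" for z
    using that by simp
  have "(\<lambda>n. exp R * R * (inverse (fact n) * R ^ n)) \<longlonglongrightarrow> exp R * R * 0"
    by (intro tendsto_intros summable_LIMSEQ_zero summable_exp)
  then have "eventually (\<lambda>n. exp R * R * (inverse (fact n) * R ^ n) < \<eta>) sequentially"
    using \<eta> by (intro order_tendstoD(2)) auto
  then obtain n where n: "exp R * R * (inverse (fact n) * R ^ n) < \<eta>"
    by (auto simp: eventually_sequentially)
  define F where "F = (\<Sum>i\<le>n. smult (1 / fact i) (q ^ i))"
  have F: "poly F z = (\<Sum>i\<le>n. poly q z ^ i / fact i)" for z
    by (simp add: F_def poly_sum)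
  have "cmod (poly F z - exp (poly q z)) \<le> \<eta>" if z: "cmod z \<le> 1" for z
  proof -
    have "cmod (poly F z - exp (poly q z)) \<le>
        exp (cmod (poly q z)) * (cmod (poly q z) ^ Suc n) / fact n"
      unfolding F norm_minus_commute[of "sum _ _"] by (rule Taylor_exp_field)
    also have "\<dots> \<le> exp R * R ^ Suc n / fact n"
      using R'[OF z] by (intro divide_right_mono mult_mono power_mono) auto
    also have "\<dots> = exp R * R * (inverse (fact n) * R ^ n)"
      by (simp add: field_simps)
    finally show ?thesis
      using n by simp
  qed
  moreover have "poly F 0 = 1"
  proof -
    have "poly F 0 = (\<Sum>i\<le>n. if i = 0 then 1 else 0)"
      unfolding F q by (intro sum.cong) auto
    then show ?thesis
      by simp
  qed
  ultimately show ?thesis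
    by blast
qed

lemma (in closed_disk_measure) uniformly_close_imp_Lt_close:
  assumes t: "0 < t" and e: "0 < e"
  shows "\<exists>\<eta>>0. \<forall>f g. (\<forall>z. cmod z \<le> 1 \<longrightarrow> cmod (f z - g z) \<le> \<eta>) \<longrightarrow> Lt_dist t M f g < ennreal e"
proof -
  define k where "k = measure M (space M) + 1"
  have k: "0 < k"
    by (simp add: k_def add_nonneg_pos)
  define \<eta> where "\<eta> = (e / k) powr (1 / t)"
  have \<eta>: "\<eta> powr t = e / k" "0 < \<eta>"
    using e k t by (simp_all add: \<eta>_def powr_powr)
  have "Lt_dist t M f g < ennreal e" if fg: "\<And>z. cmod z \<le> 1 \<Longrightarrow> cmod (f z - g z) \<le> \<eta>" for f g
  proof -
    have "Lt_dist t M f g \<le> (\<integral>\<^sup>+z. ennreal (e / k) \<partial>M)"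
      unfolding Lt_dist_def \<eta>(1)[symmetric] using AE_closed_disk t
      by (intro nn_integral_mono_AE) (auto intro!: ennreal_leI powr_mono2 fg elim!: eventually_mono)
    also have "\<dots> = ennreal (e / k * measure M (space M))"
      using e k by (subst ennreal_mult) (auto simp: emeasure_eq_measure)
    also have "\<dots> < ennreal e"
    proof (rule ennreal_lessI[OF e])
      have "e / k * measure M (space M) < e / k * k"
        using e k by (intro mult_strict_left_mono) (auto simp: k_def)
      then show "e / k * measure M (space M) < e"
        using k by simp
    qed
    finally show ?thesis .
  qed
  then show ?thesis
    using \<eta>(2) by blast
qed

text \<open>This is where the conditions on \<open>G\<close> and on \<open>w\<close> come together, through
  \<open>\<bar>exp q\<bar>\<^sup>t = exp (t Re q)\<close> on the circle and \<open>\<bar>exp q - 1\<bar> \<le> \<bar>q\<bar> exp \<bar>q\<bar>\<close> in the disk.\<close>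

lemma separating_polynomial:
  fixes W :: "complex \<Rightarrow> real"
  assumes G: "mono_on {0..1} G" and G1: "\<And>x. x \<in> {0..1} \<Longrightarrow> G x \<in> {0..<1}"
    and c: "0 < c" and x0: "0 < x0" and decay: "\<And>x. 0 < x \<Longrightarrow> x < x0 \<Longrightarrow> G x \<le> exp (- c / x)"
    and [measurable]: "W \<in> borel_measurable borel" and W: "\<And>z. 0 \<le> W z"
    and fin: "(\<integral>\<^sup>+z. ennreal (W z) \<partial>circle_measure) < \<infinity>"
    and inf: "\<And>a b. 0 \<le> a \<Longrightarrow> a < b \<Longrightarrow> b \<le> 2 * pi \<Longrightarrow>
      (\<integral>\<^sup>+\<theta>. e2ennreal (- eln (ennreal (W (cis \<theta>)))) * indicator {a..b} \<theta> \<partial>lborel) = \<infinity>"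
    and T: "closed_disk_measure (density circle_measure (\<lambda>z. ennreal (W z)))"
    and t: "0 < t" and e: "0 < e"
  shows "\<exists>F. poly F 0 = 1 \<and>
    Lt_dist t (density circle_measure (\<lambda>z. ennreal (W z))) (poly F) (\<lambda>_. 0) < ennreal e \<and>
    Lt_dist t (disk_part G) (poly F) (\<lambda>_. 1) < ennreal e"
proof -
  define \<mu>T where "\<mu>T = density circle_measure (\<lambda>z. ennreal (W z))"
  interpret D: closed_disk_measure "disk_part G"
    by (rule closed_disk_measure_disk_part[OF G G1])
  interpret T: closed_disk_measure \<mu>T
    unfolding \<mu>T_def by (rule T)
  define e' where "e' = e / (2 * 2 powr t)"
  have e': "0 < e'"
    using e by (simp add: e'_def)
  obtain \<delta> where \<delta>: "0 < \<delta>" "(\<integral>\<^sup>+z. ennreal ((\<delta> / (1 - cmod z) * exp (\<delta> / (1 - cmod z))) powr t)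
      \<partial>disk_part G) < ennreal e'"
    using growth_integral_small[OF G G1 c x0 decay t e'] by blast
  define \<epsilon> where "\<epsilon> = min \<delta> e'"
  have \<epsilon>: "0 < \<epsilon>" "\<epsilon> \<le> \<delta>" "\<epsilon> \<le> e'"
    using \<delta>(1) e' by (auto simp: \<epsilon>_def)
  obtain q where q: "poly q 0 = 0"
      "(\<integral>\<^sup>+z. ennreal (exp (t * Re (poly q z)) * W z) \<partial>circle_measure) < ennreal \<epsilon>"
      "\<And>z. cmod z < 1 \<Longrightarrow> cmod (poly q z) \<le> \<epsilon> / (1 - cmod z)"
    using poly_small_on_circle_and_disk[OF _ W fin inf t \<epsilon>(1)] by auto
  define E where "E = (\<lambda>z. exp (poly q z))"
  have [measurable]: "E \<in> borel_measurable borel"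
    unfolding E_def by (intro borel_measurable_continuous_onI continuous_intros)
  have "Lt_dist t \<mu>T E (\<lambda>_. 0) = (\<integral>\<^sup>+z. ennreal (W z) * ennreal (exp (t * Re (poly q z))) \<partial>circle_measure)"
    unfolding Lt_dist_def \<mu>T_def by (subst nn_integral_density) (auto simp: E_def powr_def)
  also have "\<dots> = (\<integral>\<^sup>+z. ennreal (exp (t * Re (poly q z)) * W z) \<partial>circle_measure)"
    using W by (simp add: ennreal_mult mult.commute)
  also have "\<dots> < ennreal e'"
    using q(2) \<epsilon>(3) by (meson ennreal_leI order_less_le_trans)
  finally have ET: "Lt_dist t \<mu>T E (\<lambda>_. 0) < ennreal e'" .
  have "Lt_dist t (disk_part G) E (\<lambda>_. 1) \<le>
      (\<integral>\<^sup>+z. ennreal ((\<delta> / (1 - cmod z) * exp (\<delta> / (1 - cmod z))) powr t) \<partial>disk_part G)"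
    unfolding Lt_dist_def
  proof (rule nn_integral_mono_AE)
    show "AE z in disk_part G. ennreal (cmod (E z - 1) powr t) \<le>
        ennreal ((\<delta> / (1 - cmod z) * exp (\<delta> / (1 - cmod z))) powr t)"
      using AE_disk_part[OF G]
    proof eventually_elim
      case (elim z)
      have "\<epsilon> / (1 - cmod z) \<le> \<delta> / (1 - cmod z)"
        using \<epsilon>(2) elim by (intro divide_right_mono) auto
      with q(3)[OF elim] have qz: "cmod (poly q z) \<le> \<delta> / (1 - cmod z)"
        by simp
      have "cmod (E z - 1) \<le> exp (cmod (poly q z)) * cmod (poly q z)"
        using Taylor_exp_field[of "poly q z" 0] by (simp add: E_def)
      also have "\<dots> \<le> exp (\<delta> / (1 - cmod z)) * (\<delta> / (1 - cmod z))"
        using qz by (intro mult_mono) auto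
      finally show ?case
        using t by (intro ennreal_leI powr_mono2) (auto simp: mult.commute)
    qed
  qed
  with \<delta>(2) have ED: "Lt_dist t (disk_part G) E (\<lambda>_. 1) < ennreal e'"
    by simp
  obtain \<eta>1 where \<eta>1: "0 < \<eta>1" "\<And>f g. (\<And>z. cmod z \<le> 1 \<Longrightarrow> cmod (f z - g z) \<le> \<eta>1) \<Longrightarrow>
      Lt_dist t \<mu>T f g < ennreal e'"
    using T.uniformly_close_imp_Lt_close[OF t e'] by blast
  obtain \<eta>2 where \<eta>2: "0 < \<eta>2" "\<And>f g. (\<And>z. cmod z \<le> 1 \<Longrightarrow> cmod (f z - g z) \<le> \<eta>2) \<Longrightarrow>
      Lt_dist t (disk_part G) f g < ennreal e'"
    using D.uniformly_close_imp_Lt_close[OF t e'] by blast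
  obtain F where F: "poly F 0 = 1" "\<And>z. cmod z \<le> 1 \<Longrightarrow> cmod (poly F z - E z) \<le> min \<eta>1 \<eta>2"
    using exp_poly_uniform_approx[OF q(1), of "min \<eta>1 \<eta>2"] \<eta>1(1) \<eta>2(1) unfolding E_def by auto
  have "Lt_dist t \<mu>T (poly F) (\<lambda>_. 0) < ennreal e"
    by (rule Lt_dist_triangle_less[OF t _ _ _ \<eta>1(2)[unfolded e'_def] ET[unfolded e'_def]])
      (use F(2) in auto)
  moreover have "Lt_dist t (disk_part G) (poly F) (\<lambda>_. 1) < ennreal e"
    by (rule Lt_dist_triangle_less[OF t _ _ _ \<eta>2(2)[unfolded e'_def] ED[unfolded e'_def]])
      (use F(2) in auto)
  ultimately show ?thesis
    using F(1) unfolding \<mu>T_def by blast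
qed

section \<open>Density of the polynomials on the circle\<close>

text \<open>Compares \<open>L\<^sup>t\<close> with \<open>L\<^sup>1\<close> on bounded functions, for \<open>t\<close> on either side of \<open>1\<close>.\<close>

lemma powr_le_linear:
  fixes x d R t :: real
  assumes "0 \<le> x" "x \<le> R" "0 < d" "0 < t"
  shows "x powr t \<le> d powr t + R powr t / d * x"
proof (cases "x \<le> d")
  case True
  then have "x powr t \<le> d powr t"
    using assms by (intro powr_mono2) auto
  moreover have "0 \<le> R powr t / d * x"
    using assms by simp
  ultimately show ?thesis
    by linarith
next
  case False
  have "x powr t \<le> R powr t"
    using assms by (intro powr_mono2) auto
  also have "\<dots> = R powr t * 1"
    by simp
  also have "\<dots> \<le> R powr t * (x / d)"
    using assms False by (intro mult_left_mono) auto
  finally show ?thesis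
    by (simp add: add_increasing)
qed

text \<open>The assumption \<open>infimum_zero\<close> says that the extremal problem of Szego and Kolmogorov, to minimize
  the integral of \<open>\<bar>F\<bar>\<^sup>t\<close> among the polynomials with \<open>F(0) = 1\<close>, has the value \<open>0\<close>. In this locale it is
  shown to imply that the polynomials are dense in \<open>L\<^sup>t\<close>.\<close>

locale Szego_circle_measure = closed_disk_measure M for M +
  fixes t :: real
  assumes t: "0 < t" and AE_circle: "AE z in M. cmod z = 1"
    and infimum_zero: "\<And>e. 0 < e \<Longrightarrow> \<exists>F. poly F 0 = 1 \<and> Lt_dist t M (poly F) (\<lambda>_. 0) < ennreal e"
begin

lemma poly_approximable_cong_circle:
  assumes f: "f \<in> borel_measurable borel" and g: "g \<in> borel_measurable borel" "poly_approximable t M g"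
    and eq: "\<And>z. cmod z = 1 \<Longrightarrow> f z = g z"
  shows "poly_approximable t M f"
proof (rule poly_approximable_limit[OF t f])
  fix e :: real assume "0 < e"
  have "Lt_dist t M f g = Lt_dist t M g g"
    using AE_circle by (intro Lt_dist_cong_AE) (auto simp: eq elim!: eventually_mono)
  also have "\<dots> = 0"
    by (simp add: Lt_dist_def)
  finally show "\<exists>g\<in>borel_measurable borel. poly_approximable t M g \<and> Lt_dist t M f g < ennreal e"
    using g \<open>0 < e\<close> by (intro bexI[of _ g]) auto
qed

lemma borel_measurable_cnj [measurable]: "cnj \<in> borel_measurable borel"
  by (intro borel_measurable_continuous_onI continuous_intros)

text \<open>If \<open>F\<close> is nearly extremal, then \<open>(1 - F) / z\<close> is a polynomial, and on the circle it differs from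
  \<open>1 / z = cnj z\<close> by \<open>F / z\<close>.\<close>

lemma poly_approximable_cnj: "poly_approximable t M cnj"
  unfolding poly_approximable_def
proof (intro allI impI)
  fix e :: real assume "0 < e"
  then obtain F where F: "poly F 0 = 1" "Lt_dist t M (poly F) (\<lambda>_. 0) < ennreal e"
    using infimum_zero by blast
  have "poly (1 - F) 0 = 0"
    using F by simp
  then obtain P where P: "1 - F = [:0, 1:] * P"
    using poly_eq_0_iff_dvd[of "1 - F" 0] by (auto elim: dvdE)
  have "Lt_dist t M cnj (poly P) < ennreal e"
  proof (rule Lt_dist_less_if_le_mult[OF _ _ t, of _ _ _ 1])
    show "AE z in M. cmod (cnj z - poly P z) \<le> 1 * cmod (poly F z - 0)"
      using AE_circle
    proof eventually_elim
      case (elim z)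
      have "1 - poly F z = z * poly P z"
        using arg_cong[OF P, of "\<lambda>p. poly p z"] by simp
      then have "poly F z = (cnj z * z) - z * poly P z"
        unfolding cnj_mult_self_circle[OF elim] by (simp add: algebra_simps)
      also have "\<dots> = z * (cnj z - poly P z)"
        by (simp add: algebra_simps)
      finally show ?case
        using elim by (simp add: norm_mult)
    qed
  qed (use F(2) t in auto)
  then show "\<exists>p. Lt_dist t M cnj (poly p) < ennreal e" ..
qed

text \<open>Multiplication by \<open>cnj z\<close> is isometric, and it maps a polynomial \<open>a + z p\<close> to \<open>a cnj z + p\<close>.\<close>

lemma poly_approximable_cnj_mult:
  assumes [measurable]: "f \<in> borel_measurable borel" and f: "poly_approximable t M f"
  shows "poly_approximable t M (\<lambda>z. cnj z * f z)"
proof (rule poly_approximable_limit[OF t])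
  fix e :: real assume "0 < e"
  with f obtain p where p: "Lt_dist t M f (poly p) < ennreal e"
    unfolding poly_approximable_def by blast
  have "Lt_dist t M (\<lambda>z. cnj z * f z) (\<lambda>z. cnj z * poly p z) < ennreal e"
  proof (rule Lt_dist_less_if_le_mult[OF _ _ t, of _ _ _ 1])
    show "AE z in M. cmod (cnj z * f z - cnj z * poly p z) \<le> 1 * cmod (f z - poly p z)"
      using AE_circle by (auto simp: norm_mult simp flip: right_diff_distrib elim!: eventually_mono)
  qed (use p t in auto)
  moreover have "poly_approximable t M (\<lambda>z. cnj z * poly p z)"
  proof (cases p)
    case (pCons a p1)
    show ?thesis
    proof (rule poly_approximable_cong_circle)
      show "poly_approximable t M (\<lambda>z. poly [:a:] z * cnj z + poly p1 z)"
        by (intro poly_approximable_add poly_approximable_mult_poly poly_approximable_poly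
            poly_approximable_cnj t) auto
      fix z :: complex assume z: "cmod z = 1"
      have "cnj z * poly p z = a * cnj z + (cnj z * z) * poly p1 z"
        by (simp add: pCons algebra_simps)
      then show "cnj z * poly p z = poly [:a:] z * cnj z + poly p1 z"
        unfolding cnj_mult_self_circle[OF z] by simp
    qed auto
  qed
  ultimately show "\<exists>g\<in>borel_measurable borel. poly_approximable t M g \<and>
      Lt_dist t M (\<lambda>z. cnj z * f z) g < ennreal e"
    by (intro bexI[of _ "\<lambda>z. cnj z * poly p z"]) auto
qed measurable

lemma poly_approximable_cnj_poly: "poly_approximable t M (\<lambda>z. cnj (poly p z))"
proof (induction p)
  case 0
  then show ?case
    using poly_approximable_poly[of t 0] by (simp add: poly_0[abs_def])
next
  case (pCons a p)
  have "poly_approximable t M (\<lambda>z. poly [:cnj a:] z + cnj z * cnj (poly p z))"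
    by (intro poly_approximable_add poly_approximable_poly poly_approximable_cnj_mult pCons t)
      (auto intro: measurable_compose[OF borel_measurable_poly borel_measurable_cnj])
  then show ?case
    by simp
qed

lemma poly_approximable_Re_poly: "poly_approximable t M (\<lambda>z. of_real (Re (poly p z)))"
proof -
  have "poly_approximable t M (\<lambda>z. poly [:1 / 2:] z * (poly p z + cnj (poly p z)))"
    by (intro poly_approximable_mult_poly poly_approximable_add poly_approximable_poly
        poly_approximable_cnj_poly t)
      (auto intro: measurable_compose[OF borel_measurable_poly borel_measurable_cnj])
  moreover have "poly [:1 / 2:] z * (poly p z + cnj (poly p z)) = of_real (Re (poly p z))" for z
    unfolding complex_add_cnj by simp
  ultimately show ?thesis
    by simp
qed

lemma poly_approximable_bounded_real:
  fixes f :: "complex \<Rightarrow> real"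
  assumes f [measurable]: "f \<in> borel_measurable borel" and B: "\<And>z. \<bar>f z\<bar> \<le> B"
  shows "poly_approximable t M (\<lambda>z. of_real (f z))"
proof (rule poly_approximable_limit[OF t])
  fix e :: real assume e: "0 < e"
  define k where "k = measure M (space M) + 1"
  have k: "0 < k"
    by (simp add: k_def add_nonneg_pos)
  define R where "R = 2 * B + 1"
  have R: "0 < R"
    using B[of 0] by (simp add: R_def)
  define d where "d = (e / (4 * k)) powr (1 / t)"
  have d: "0 < d" "d powr t = e / (4 * k)"
    using e k t by (simp_all add: d_def powr_powr)
  define C where "C = R powr t / d"
  have C: "0 < C"
    using R d by (simp add: C_def)
  have "0 < e / (4 * C)"
    using e C by simp
  then obtain q where "\<forall>z\<in>sphere 0 1. \<bar>Re (poly q z)\<bar> \<le> B + 1"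
      and q: "(\<integral>\<^sup>+z. ennreal \<bar>f z - Re (poly q z)\<bar> \<partial>M) < ennreal (e / (4 * C))"
    using bounded_approx_Re_poly[OF finite_measure_axioms sets_eq_borel AE_circle f B] by blast
  then have qB: "\<And>z. cmod z = 1 \<Longrightarrow> \<bar>Re (poly q z)\<bar> \<le> B + 1"
    by simp
  have "Lt_dist t M (\<lambda>z. of_real (f z)) (\<lambda>z. of_real (Re (poly q z))) \<le>
      (\<integral>\<^sup>+z. ennreal (d powr t) + ennreal C * ennreal \<bar>f z - Re (poly q z)\<bar> \<partial>M)"
    unfolding Lt_dist_def
  proof (rule nn_integral_mono_AE)
    show "AE z in M. ennreal (cmod (of_real (f z) - of_real (Re (poly q z))) powr t) \<le>
        ennreal (d powr t) + ennreal C * ennreal \<bar>f z - Re (poly q z)\<bar>"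
      using AE_circle
    proof eventually_elim
      case (elim z)
      have "\<bar>f z - Re (poly q z)\<bar> \<le> R"
        using B[of z] qB[OF elim] by (simp add: R_def)
      then have "\<bar>f z - Re (poly q z)\<bar> powr t \<le> d powr t + C * \<bar>f z - Re (poly q z)\<bar>"
        unfolding C_def by (intro powr_le_linear d t) auto
      then have "ennreal (\<bar>f z - Re (poly q z)\<bar> powr t) \<le>
          ennreal (d powr t + C * \<bar>f z - Re (poly q z)\<bar>)"
        by (rule ennreal_leI)
      also have "\<dots> = ennreal (d powr t) + ennreal C * ennreal \<bar>f z - Re (poly q z)\<bar>"
        using C by (simp add: ennreal_mult)
      finally show ?case
        by (simp flip: of_real_diff)
    qed
  qed
  also have "\<dots> = ennreal (d powr t) * emeasure M (space M) +
      ennreal C * (\<integral>\<^sup>+z. ennreal \<bar>f z - Re (poly q z)\<bar> \<partial>M)"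
    by (subst nn_integral_add) (auto simp: nn_integral_cmult)
  also have "\<dots> \<le> ennreal (d powr t) * ennreal k + ennreal C * ennreal (e / (4 * C))"
    using q by (intro add_mono mult_left_mono) (auto simp: emeasure_eq_measure k_def intro!: ennreal_leI simp del: ennreal_plus)
  also have "\<dots> = ennreal (e / 2)"
    using e k C d by (simp flip: ennreal_mult ennreal_plus)
  also have "\<dots> < ennreal e"
    using e by (intro ennreal_lessI) auto
  finally have "Lt_dist t M (\<lambda>z. of_real (f z)) (\<lambda>z. of_real (Re (poly q z))) < ennreal e" .
  then show "\<exists>g\<in>borel_measurable borel. poly_approximable t M g \<and>
      Lt_dist t M (\<lambda>z. of_real (f z)) g < ennreal e"
    using poly_approximable_Re_poly[of q] by (intro bexI[of _ "\<lambda>z. of_real (Re (poly q z))"]) auto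
qed measurable

lemma poly_approximable_bounded:
  assumes f [measurable]: "f \<in> borel_measurable borel" and B: "\<And>z. cmod (f z) \<le> B"
  shows "poly_approximable t M f"
proof -
  have "\<bar>Re (f z)\<bar> \<le> B" "\<bar>Im (f z)\<bar> \<le> B" for z
    using abs_Re_le_cmod[of "f z"] abs_Im_le_cmod[of "f z"] B[of z] by linarith+
  then have "poly_approximable t M (\<lambda>z. of_real (Re (f z)) + poly [:\<i>:] z * of_real (Im (f z)))"
    by (intro poly_approximable_add poly_approximable_mult_poly poly_approximable_bounded_real t) auto
  moreover have "of_real (Re (f z)) + poly [:\<i>:] z * of_real (Im (f z)) = f z" for z
    by (simp add: complex_eq_iff)
  ultimately show ?thesis
    by simp
qed

lemma poly_approximable_Lt:
  assumes f: "f \<in> Lt t M"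
  shows "poly_approximable t M f"
proof -
  have [measurable]: "f \<in> borel_measurable borel"
    using f by (auto simp: Lt_def cong: measurable_cong_sets)
  have fin: "(\<integral>\<^sup>+z. ennreal (cmod (f z) powr t) \<partial>M) < \<infinity>"
    using f by (simp add: mem_Lt_iff Lt_dist_def)
  define g where "g = (\<lambda>n z. if cmod (f z) \<le> real n then f z else 0)"
  have [measurable]: "g n \<in> borel_measurable borel" for n
    unfolding g_def by measurable
  show ?thesis
  proof (rule poly_approximable_limit[OF t])
    fix e :: real assume e: "0 < e"
    have "(\<lambda>n. \<integral>\<^sup>+z. ennreal (cmod (f z - g n z) powr t) \<partial>M) \<longlonglongrightarrow> (\<integral>\<^sup>+z. 0 \<partial>M)"
    proof (rule nn_integral_dominated_convergence[OF _ _ _ _ fin])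
      show "AE z in M. ennreal (cmod (f z - g n z) powr t) \<le> ennreal (cmod (f z) powr t)" for n
        using t by (intro AE_I2) (auto simp: g_def)
      show "AE z in M. (\<lambda>n. ennreal (cmod (f z - g n z) powr t)) \<longlonglongrightarrow> 0"
      proof (intro AE_I2 tendsto_eventually)
        fix z
        obtain n0 :: nat where "cmod (f z) \<le> real n0"
          using real_arch_simple by blast
        then show "\<forall>\<^sub>F n in sequentially. ennreal (cmod (f z - g n z) powr t) = 0"
          by (intro eventually_sequentiallyI[of n0]) (auto simp: g_def)
      qed
    qed measurable
    from order_tendstoD(2)[OF this, of "ennreal e"] e
    obtain n where "Lt_dist t M f (g n) < ennreal e"
      by (auto simp: eventually_sequentially Lt_dist_def)
    moreover have "poly_approximable t M (g n)"
      by (rule poly_approximable_bounded[of _ "real n"]) (auto simp: g_def)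
    ultimately show "\<exists>g\<in>borel_measurable borel. poly_approximable t M g \<and> Lt_dist t M f g < ennreal e"
      by (intro bexI[of _ "g n"]) auto
  qed measurable
qed

end

section \<open>Splitting\<close>

lemma Lt_dist_add_measure:
  assumes "sets M = sets N" "f \<in> borel_measurable M" "g \<in> borel_measurable M"
  shows "Lt_dist t (add_measure M N) f g = Lt_dist t M f g + Lt_dist t N f g"
  unfolding Lt_dist_def using assms by (intro nn_integral_add_measure) measurable

lemma (in closed_disk_measure) space_eq_UNIV: "space M = UNIV"
  using sets_eq_imp_space_eq[OF sets_eq_borel] by simp

lemma closed_disk_measure_add:
  assumes "closed_disk_measure M" "closed_disk_measure N"
  shows "closed_disk_measure (add_measure M N)"
proof -
  interpret M: closed_disk_measure M by fact
  interpret N: closed_disk_measure N by fact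
  have sets: "sets M = sets N"
    by (simp add: M.sets_eq_borel N.sets_eq_borel)
  note sp = M.space_eq_UNIV N.space_eq_UNIV
  have "emeasure (add_measure M N) UNIV = emeasure M UNIV + emeasure N UNIV"
    using M.sets_eq_borel by (intro emeasure_add_measure sets) auto
  then have "finite_measure (add_measure M N)"
    by (intro finite_measureI) (simp add: sp M.emeasure_eq_measure N.emeasure_eq_measure)
  moreover have "AE z in add_measure M N. cmod z \<le> 1"
    using M.AE_closed_disk N.AE_closed_disk
    by (subst AE_add_measure_iff[OF sets]) (auto simp: M.sets_eq_borel sp)
  ultimately show ?thesis
    unfolding closed_disk_measure_def closed_disk_measure_axioms_def
    by (simp add: M.sets_eq_borel)
qed

text \<open>If \<open>p\<close> approximates \<open>f\<close> on the disk and \<open>r\<close> approximates \<open>f - p\<close> on the circle, then \<open>p + r (1 - F)\<close>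
  approximates \<open>f\<close> on both.\<close>

lemma splitting_by_separating_polynomials:
  assumes D: "closed_disk_measure D" and T: "closed_disk_measure T" and t: "0 < t"
    and AE_D: "AE z in D. cmod z < 1" and AE_T: "AE z in T. cmod z = 1"
    and separating: "\<And>e. 0 < e \<Longrightarrow> \<exists>F. poly F 0 = 1 \<and> Lt_dist t T (poly F) (\<lambda>_. 0) < ennreal e \<and>
      Lt_dist t D (poly F) (\<lambda>_. 1) < ennreal e"
  shows "f \<in> Pt t (add_measure D T) \<longleftrightarrow> f \<in> Lt t (add_measure D T) \<and> poly_approximable t D f"
proof -
  interpret D: closed_disk_measure D by fact
  interpret T: closed_disk_measure T by fact
  interpret DT: closed_disk_measure "add_measure D T"
    by (intro closed_disk_measure_add D T)
  interpret T: Szego_circle_measure T t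
    using t AE_T separating by unfold_locales blast+
  have sets: "sets D = sets T"
    by (simp add: D.sets_eq_borel T.sets_eq_borel)
  have meas: "f \<in> borel_measurable D \<longleftrightarrow> f \<in> borel_measurable borel"
    "f \<in> borel_measurable T \<longleftrightarrow> f \<in> borel_measurable borel" for f :: "complex \<Rightarrow> complex"
    using D.sets_eq_borel T.sets_eq_borel by (auto cong: measurable_cong_sets)
  have dist: "Lt_dist t (add_measure D T) f g = Lt_dist t D f g + Lt_dist t T f g"
    if "f \<in> borel_measurable borel" "g \<in> borel_measurable borel" for f g
    using that by (intro Lt_dist_add_measure sets) (auto simp: meas)
  have zero_plus_poly: "\<exists>r. Lt_dist t D (poly r) (\<lambda>_. 0) < ennreal e \<and> Lt_dist t T (poly r) (poly p) < ennreal e"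
    if e: "0 < e" for e p
  proof -
    have "compact (poly p ` cball 0 1)"
      by (intro compact_continuous_image continuous_intros) auto
    then obtain C where C: "0 < C" "\<forall>w\<in>poly p ` cball 0 1. cmod w \<le> C"
      using compact_imp_bounded[of "poly p ` cball 0 1"] by (auto simp: bounded_pos)
    then have C': "\<And>z. cmod z \<le> 1 \<Longrightarrow> cmod (poly p z) \<le> C"
      by simp
    have "0 < e / C powr t"
      using e C(1) by simp
    from separating[OF this] obtain F where F: "Lt_dist t T (poly F) (\<lambda>_. 0) < ennreal (e / C powr t)"
        "Lt_dist t D (poly F) (\<lambda>_. 1) < ennreal (e / C powr t)"
      by blast
    have "Lt_dist t D (poly (p * (1 - F))) (\<lambda>_. 0) < ennreal e"
    proof (rule Lt_dist_less_if_le_mult[OF _ _ t C(1) _ F(2)])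
      show "AE z in D. cmod (poly (p * (1 - F)) z - 0) \<le> C * cmod (poly F z - 1)"
        using D.AE_closed_disk
        by eventually_elim (simp add: norm_mult norm_minus_commute[of 1] mult_right_mono C')
    qed (auto simp: meas)
    moreover have "Lt_dist t T (poly (p * (1 - F))) (poly p) < ennreal e"
    proof (rule Lt_dist_less_if_le_mult[OF _ _ t C(1) _ F(1)])
      show "AE z in T. cmod (poly (p * (1 - F)) z - poly p z) \<le> C * cmod (poly F z - 0)"
        using T.AE_closed_disk
      proof eventually_elim
        case (elim z)
        have "poly (p * (1 - F)) z - poly p z = - (poly p z * poly F z)"
          by (simp add: algebra_simps)
        then show ?case
          using C'[OF elim] by (simp add: norm_mult mult_right_mono)
      qed
    qed (auto simp: meas)
    ultimately show ?thesis
      by blast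
  qed
  have "poly_approximable t (add_measure D T) f \<longleftrightarrow> poly_approximable t D f"
    if f: "f \<in> Lt t (add_measure D T)" for f
  proof
    have fb [measurable]: "f \<in> borel_measurable borel"
      using f by (auto simp: Lt_def meas)
    {
      assume f_approx: "poly_approximable t (add_measure D T) f"
      have "Lt_dist t D f (poly p) \<le> Lt_dist t (add_measure D T) f (poly p)" for p
        unfolding dist[OF fb borel_measurable_poly] by simp
      with f_approx show "poly_approximable t D f"
        unfolding poly_approximable_def by (blast intro: order.strict_trans1)
    }
    assume fD: "poly_approximable t D f"
    have "Lt_dist t T f (\<lambda>_. 0) < \<infinity>"
      using f dist[OF fb, of "\<lambda>_. 0"] by (auto simp: mem_Lt_iff)
    then have "f \<in> Lt t T"
      by (simp add: mem_Lt_iff meas fb)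
    then have fT: "poly_approximable t T f"
      by (rule T.poly_approximable_Lt)
    show "poly_approximable t (add_measure D T) f"
      unfolding poly_approximable_def
    proof (intro allI impI)
      fix e :: real assume "0 < e"
      define e' where "e' = e / 2 / (2 * 2 powr t)"
      have e': "0 < e'"
        using \<open>0 < e\<close> by (simp add: e'_def)
      obtain p where p: "Lt_dist t D f (poly p) < ennreal e'"
        using fD e' unfolding poly_approximable_def by blast
      have "poly_approximable t T (\<lambda>z. f z + poly (- p) z)"
        by (intro T.poly_approximable_add T.poly_approximable_poly fT t) auto
      then obtain r where r: "Lt_dist t T (\<lambda>z. f z - poly p z) (poly r) < ennreal e'"
        using e' unfolding poly_approximable_def by auto
      obtain s where s: "Lt_dist t D (poly s) (\<lambda>_. 0) < ennreal e'" "Lt_dist t T (poly s) (poly r) < ennreal e'"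
        using zero_plus_poly[OF e'] by blast
      have "Lt_dist t D f (poly (p + s)) < ennreal (e / 2)"
      proof (rule Lt_dist_triangle_less[OF t _ _ _ p[unfolded e'_def]])
        show "Lt_dist t D (poly p) (poly (p + s)) < ennreal (e / 2 / (2 * 2 powr t))"
          using s(1) unfolding Lt_dist_commute[of t D "poly s"] e'_def
          by (subst Lt_dist_cong_AE[where f' = "\<lambda>_. 0" and g' = "poly s"]) auto
      qed (auto simp: meas)
      moreover have "Lt_dist t T f (poly (p + s)) < ennreal (e / 2)"
      proof (rule Lt_dist_triangle_less[OF t, where g = "\<lambda>z. poly p z + poly r z"])
        show "Lt_dist t T f (\<lambda>z. poly p z + poly r z) < ennreal (e / 2 / (2 * 2 powr t))"
          using r unfolding e'_def
          by (subst Lt_dist_cong_AE[where f' = "\<lambda>z. f z - poly p z" and g' = "poly r"]) auto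
        show "Lt_dist t T (\<lambda>z. poly p z + poly r z) (poly (p + s)) < ennreal (e / 2 / (2 * 2 powr t))"
          using s(2) unfolding Lt_dist_commute[of t T "poly s"] e'_def
          by (subst Lt_dist_cong_AE[where f' = "poly r" and g' = "poly s"]) auto
      qed (auto simp: meas)
      ultimately have "Lt_dist t (add_measure D T) f (poly (p + s)) < ennreal e"
        by (subst dist) (auto intro: ennreal_add_less_halves)
      then show "\<exists>p. Lt_dist t (add_measure D T) f (poly p) < ennreal e" ..
    qed
  qed
  then show ?thesis
    using DT.mem_Pt_iff[OF t] by blast
qed

text \<open>The first summand consists of the functions of \<open>L\<^sup>t(\<mu>)\<close> that vanish on the circle and are approximable
  on the disk, the second one of those that vanish on the disk.\<close>

lemma Lt_direct_sum_of_splitting: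
  assumes D: "closed_disk_measure D" and T: "closed_disk_measure T" and t: "0 < t"
    and AE_D: "AE z in D. cmod z < 1" and AE_T: "AE z in T. cmod z = 1"
    and split: "\<And>f. f \<in> Pt t (add_measure D T) \<longleftrightarrow> f \<in> Lt t (add_measure D T) \<and> poly_approximable t D f"
  defines "\<mu> \<equiv> add_measure D T"
  shows "Lt_direct_sum t \<mu> (Pt t \<mu>) (extend_zero t \<mu> (ball 0 1) (Pt t D))
    (extend_zero t \<mu> (sphere 0 1) (Lt t T))"
proof -
  interpret D: closed_disk_measure D by fact
  interpret T: closed_disk_measure T by fact
  interpret \<mu>: closed_disk_measure \<mu>
    unfolding \<mu>_def by (intro closed_disk_measure_add D T)
  have sets: "sets D = sets T"
    by (simp add: D.sets_eq_borel T.sets_eq_borel)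
  note sp = D.space_eq_UNIV T.space_eq_UNIV
  have meas: "f \<in> borel_measurable D \<longleftrightarrow> f \<in> borel_measurable borel"
    "f \<in> borel_measurable T \<longleftrightarrow> f \<in> borel_measurable borel"
    "f \<in> borel_measurable \<mu> \<longleftrightarrow> f \<in> borel_measurable borel" for f :: "complex \<Rightarrow> complex"
    using D.sets_eq_borel T.sets_eq_borel \<mu>.sets_eq_borel by (auto cong: measurable_cong_sets)
  have Lt_meas: "f \<in> borel_measurable borel" if "f \<in> Lt t D \<or> f \<in> Lt t T \<or> f \<in> Lt t \<mu>" for f
    using that meas by (auto simp: Lt_def)
  have AE_\<mu>: "(AE z in \<mu>. f z = g z) \<longleftrightarrow> (AE z in D. f z = g z) \<and> (AE z in T. f z = g z)"
    if "f \<in> borel_measurable borel" "g \<in> borel_measurable borel" for f g :: "complex \<Rightarrow> complex"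
    unfolding \<mu>_def using that by (intro AE_add_measure_iff sets) (auto simp: D.sets_eq_borel sp)
  have Lt_\<mu>: "f \<in> Lt t \<mu> \<longleftrightarrow> f \<in> Lt t D \<and> f \<in> Lt t T" for f
  proof (cases "f \<in> borel_measurable borel")
    case True
    then have "Lt_dist t \<mu> f (\<lambda>_. 0) = Lt_dist t D f (\<lambda>_. 0) + Lt_dist t T f (\<lambda>_. 0)"
      unfolding \<mu>_def by (intro Lt_dist_add_measure sets) (auto simp: meas)
    then show ?thesis
      by (simp add: mem_Lt_iff meas True)
  qed (auto simp: mem_Lt_iff meas)
  have Lt_cong: "f \<in> Lt t M \<longleftrightarrow> g \<in> Lt t M"
    if "AE z in M. f z = g z" "f \<in> borel_measurable M" "g \<in> borel_measurable M" for f g M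
    using that by (simp add: mem_Lt_iff Lt_dist_cong_AE[of f "\<lambda>_. 0" g "\<lambda>_. 0" M])
  have approx_cong: "poly_approximable t D f \<longleftrightarrow> poly_approximable t D g"
    if "AE z in D. f z = g z" for f g
  proof -
    have "Lt_dist t D f (poly p) = Lt_dist t D g (poly p)" for p
      using that by (intro Lt_dist_cong_AE) (auto elim!: eventually_mono)
    then show ?thesis
      by (simp add: poly_approximable_def)
  qed
  have zero_Lt: "(\<lambda>_. 0) \<in> Lt t M" for M :: "complex measure"
    by (simp add: mem_Lt_iff Lt_dist_def)
  have zero_approx: "poly_approximable t D (\<lambda>_. 0)"
    using D.poly_approximable_poly[of t 0] by (simp add: poly_0[abs_def])
  have [measurable]: "ball (0::complex) 1 \<in> sets borel" "sphere (0::complex) 1 \<in> sets borel"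
    by auto
  have restrict_meas: "(\<lambda>z. if z \<in> S then g z else 0) \<in> borel_measurable borel"
    if "g \<in> borel_measurable borel" "S \<in> sets borel" for g :: "complex \<Rightarrow> complex" and S
    using that by measurable
  have A: "f \<in> extend_zero t \<mu> (ball 0 1) (Pt t D) \<longleftrightarrow>
      f \<in> Lt t \<mu> \<and> poly_approximable t D f \<and> (AE z in T. f z = 0)" for f
  proof
    assume "f \<in> extend_zero t \<mu> (ball 0 1) (Pt t D)"
    then obtain g where f: "f \<in> Lt t \<mu>" and g: "g \<in> Lt t D" "poly_approximable t D g"
      and eq: "AE z in \<mu>. f z = (if z \<in> ball 0 1 then g z else 0)"
      using D.mem_Pt_iff[OF t] by (auto simp: extend_zero_def)
    have "(\<lambda>z. if z \<in> ball 0 1 then g z else 0) \<in> borel_measurable borel"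
      using g Lt_meas by (intro restrict_meas) auto
    then have eq': "AE z in D. f z = (if z \<in> ball 0 1 then g z else 0)"
      "AE z in T. f z = (if z \<in> ball 0 1 then g z else 0)"
      using eq f Lt_meas by (auto simp: AE_\<mu>)
    have "AE z in D. f z = g z"
      using eq'(1) AE_D by eventually_elim auto
    moreover have "AE z in T. f z = 0"
      using eq'(2) AE_T by eventually_elim auto
    ultimately show "f \<in> Lt t \<mu> \<and> poly_approximable t D f \<and> (AE z in T. f z = 0)"
      using f g approx_cong by blast
  next
    assume f: "f \<in> Lt t \<mu> \<and> poly_approximable t D f \<and> (AE z in T. f z = 0)"
    then have fb: "f \<in> borel_measurable borel"
      using Lt_meas by blast
    have "AE z in D. f z = (if z \<in> ball 0 1 then f z else 0)"
      using AE_D by eventually_elim auto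
    moreover have "AE z in T. f z = (if z \<in> ball 0 1 then f z else 0)"
      using conjunct2[OF conjunct2[OF f]] by eventually_elim simp
    ultimately have "AE z in \<mu>. f z = (if z \<in> ball 0 1 then f z else 0)"
      using fb by (subst AE_\<mu>) (auto intro: restrict_meas)
    then show "f \<in> extend_zero t \<mu> (ball 0 1) (Pt t D)"
      using f Lt_\<mu> D.mem_Pt_iff[OF t] by (auto simp: extend_zero_def)
  qed
  have B: "f \<in> extend_zero t \<mu> (sphere 0 1) (Lt t T) \<longleftrightarrow> f \<in> Lt t \<mu> \<and> (AE z in D. f z = 0)" for f
  proof
    assume "f \<in> extend_zero t \<mu> (sphere 0 1) (Lt t T)"
    then obtain g where f: "f \<in> Lt t \<mu>" and g: "g \<in> Lt t T"
      and eq: "AE z in \<mu>. f z = (if z \<in> sphere 0 1 then g z else 0)"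
      by (auto simp: extend_zero_def)
    have "(\<lambda>z. if z \<in> sphere 0 1 then g z else 0) \<in> borel_measurable borel"
      using g Lt_meas by (intro restrict_meas) auto
    then have "AE z in D. f z = (if z \<in> sphere 0 1 then g z else 0)"
      using eq f Lt_meas by (auto simp: AE_\<mu>)
    then have "AE z in D. f z = 0"
      using AE_D by eventually_elim auto
    with f show "f \<in> Lt t \<mu> \<and> (AE z in D. f z = 0)"
      by simp
  next
    assume f: "f \<in> Lt t \<mu> \<and> (AE z in D. f z = 0)"
    then have fb: "f \<in> borel_measurable borel"
      using Lt_meas by blast
    have "AE z in D. f z = (if z \<in> sphere 0 1 then f z else 0)"
      using conjunct2[OF f] by eventually_elim simp
    moreover have "AE z in T. f z = (if z \<in> sphere 0 1 then f z else 0)"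
      using AE_T by eventually_elim auto
    ultimately have "AE z in \<mu>. f z = (if z \<in> sphere 0 1 then f z else 0)"
      using fb by (subst AE_\<mu>) (auto intro: restrict_meas)
    then show "f \<in> extend_zero t \<mu> (sphere 0 1) (Lt t T)"
      using f Lt_\<mu> by (auto simp: extend_zero_def)
  qed
  show ?thesis
    unfolding Lt_direct_sum_def
  proof (intro conjI set_eqI iffI)
    fix f assume "f \<in> Pt t \<mu>"
    then have f: "f \<in> Lt t \<mu>" "poly_approximable t D f"
      using split by (auto simp: \<mu>_def)
    then have fb: "f \<in> borel_measurable borel"
      using Lt_meas by blast
    define g where "g = (\<lambda>z. if z \<in> ball 0 1 then f z else 0)"
    define h where "h = (\<lambda>z. if z \<in> ball 0 1 then 0 else f z)"
    have gb: "g \<in> borel_measurable borel" and hb: "h \<in> borel_measurable borel"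
      unfolding g_def h_def using fb by measurable
    have gD: "AE z in D. f z = g z" and hD: "AE z in D. h z = 0"
      using AE_D by (auto simp: g_def h_def elim!: eventually_mono)
    have gT: "AE z in T. g z = 0" and hT: "AE z in T. f z = h z"
      using AE_T by (auto simp: g_def h_def elim!: eventually_mono)
    have "g \<in> Lt t \<mu>" "h \<in> Lt t \<mu>"
      using f Lt_\<mu> Lt_cong[OF gD] Lt_cong[OF hT] Lt_cong[OF gT] Lt_cong[OF hD] fb gb hb zero_Lt
      by (auto simp: meas)
    then have "g \<in> extend_zero t \<mu> (ball 0 1) (Pt t D)" "h \<in> extend_zero t \<mu> (sphere 0 1) (Lt t T)"
      using A B f gD gT hD approx_cong by blast+
    moreover have "AE z in \<mu>. f z = g z + h z"
      by (simp add: g_def h_def)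
    ultimately show "f \<in> {f \<in> Lt t \<mu>. \<exists>g\<in>extend_zero t \<mu> (ball 0 1) (Pt t D).
        \<exists>h\<in>extend_zero t \<mu> (sphere 0 1) (Lt t T). AE x in \<mu>. f x = g x + h x}"
      using f by blast
  next
    fix f assume "f \<in> {f \<in> Lt t \<mu>. \<exists>g\<in>extend_zero t \<mu> (ball 0 1) (Pt t D).
        \<exists>h\<in>extend_zero t \<mu> (sphere 0 1) (Lt t T). AE x in \<mu>. f x = g x + h x}"
    then obtain g h where f: "f \<in> Lt t \<mu>" and g: "g \<in> Lt t \<mu>" "poly_approximable t D g"
      and h: "h \<in> Lt t \<mu>" "AE z in D. h z = 0" and eq: "AE x in \<mu>. f x = g x + h x"
      using A B by blast
    have "f \<in> borel_measurable borel" "(\<lambda>x. g x + h x) \<in> borel_measurable borel"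
      using f g h Lt_meas by (auto intro!: borel_measurable_add)
    then have "AE x in D. f x = g x + h x"
      using eq AE_\<mu>[of f "\<lambda>x. g x + h x"] by auto
    then have "AE z in D. f z = g z"
      using h(2) by eventually_elim auto
    then have "poly_approximable t D f"
      using g approx_cong by blast
    then show "f \<in> Pt t \<mu>"
      using f split by (simp add: \<mu>_def)
  next
    fix f assume "f \<in> extend_zero t \<mu> (ball 0 1) (Pt t D) \<inter> extend_zero t \<mu> (sphere 0 1) (Lt t T)"
    then show "f \<in> {f \<in> Lt t \<mu>. AE x in \<mu>. f x = 0}"
      using A B Lt_meas AE_\<mu>[of f "\<lambda>_. 0"] by auto
  next
    fix f assume "f \<in> {f \<in> Lt t \<mu>. AE x in \<mu>. f x = 0}"
    then have f: "f \<in> Lt t \<mu>" "AE x in D. f x = 0" "AE x in T. f x = 0"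
      using Lt_meas AE_\<mu>[of f "\<lambda>_. 0"] by auto
    then have "poly_approximable t D f"
      using approx_cong[OF f(2)] zero_approx by simp
    with f show "f \<in> extend_zero t \<mu> (ball 0 1) (Pt t D) \<inter> extend_zero t \<mu> (sphere 0 1) (Lt t T)"
      using A B by blast
  qed
qed

theorem theorem2:
  fixes G :: "real \<Rightarrow> real" and w :: "complex \<Rightarrow> real" and t :: real
  assumes "\<And>x. x \<in> {0..1} \<Longrightarrow> G x \<in> {0..<1}"
    and "mono_on {0..1} G"
    and "G 0 = 0"
    and "Liminf (at_right 0) (\<lambda>x. ereal x * eln (1 / ennreal (G x))) > 0"
    and "w \<in> borel_measurable (restrict_space borel (sphere 0 1))"
    and "\<And>z. z \<in> sphere 0 1 \<Longrightarrow> 0 \<le> w z"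
    and "set_integrable circle_measure (sphere 0 1) w"
    and "\<And>I. circle_arc I \<Longrightarrow>
           ext_set_integral circle_measure I (\<lambda>z. eln (ennreal (w z))) = - \<infinity>"
    and "0 < t"
  defines "\<mu> \<equiv> add_measure (disk_part G) (circle_part w)"
  shows "Lt_direct_sum t \<mu> (Pt t \<mu>)
           (extend_zero t \<mu> (ball 0 1) (Pt t (disk_part G)))
           (extend_zero t \<mu> (sphere 0 1) (Lt t (circle_part w)))"
proof -
  define W where "W = (\<lambda>z. indicator (sphere 0 1) z * w z)"
  have W_meas [measurable]: "W \<in> borel_measurable borel"
    using assms(5) unfolding W_def by (subst (asm) borel_measurable_restrict_space_iff) auto
  have W: "0 \<le> W z" for z
    using assms(6)[of z] by (simp add: W_def indicator_def)
  have Ww: "W z = w z" if "cmod z = 1" for z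
    using that by (simp add: W_def)
  have T: "circle_part w = density circle_measure (\<lambda>z. ennreal (W z))"
    by (simp add: circle_part_def W_def)
  have fin: "(\<integral>\<^sup>+z. ennreal (W z) \<partial>circle_measure) < \<infinity>"
    using assms(7) W unfolding set_integrable_def real_scaleR_def W_def[symmetric] fun_eq_iff
    by (simp add: integrable_iff_bounded W_def)
  have AE_T: "AE z in circle_part w. cmod z = 1"
    unfolding T using AE_circle_measure by (subst AE_density) (auto elim!: eventually_mono)
  have "finite_measure (circle_part w)"
    using fin by (intro finite_measureI) (auto simp: T emeasure_density)
  then have cT: "closed_disk_measure (circle_part w)"
    unfolding closed_disk_measure_def closed_disk_measure_axioms_def
    using AE_T by (auto simp: T elim: eventually_mono)
  obtain c x0 where c: "0 < c" "0 < x0" "\<And>x. 0 < x \<Longrightarrow> x < x0 \<Longrightarrow> G x \<le> exp (- c / x)"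
    using decay_of_Liminf[OF assms(4)] by blast
  have inf: "(\<integral>\<^sup>+\<theta>. e2ennreal (- eln (ennreal (W (cis \<theta>)))) * indicator {a..b} \<theta> \<partial>lborel) = \<infinity>"
    if "0 \<le> a" "a < b" "b \<le> 2 * pi" for a b
    by (rule log_integral_infinite[OF W_meas Ww assms(8) that])
  have separating: "\<exists>F. poly F 0 = 1 \<and> Lt_dist t (circle_part w) (poly F) (\<lambda>_. 0) < ennreal e \<and>
      Lt_dist t (disk_part G) (poly F) (\<lambda>_. 1) < ennreal e" if "0 < e" for e
    unfolding T by (rule separating_polynomial[OF assms(2,1) c W_meas W fin inf cT[unfolded T] assms(9) that])
  have cD: "closed_disk_measure (disk_part G)"
    by (rule closed_disk_measure_disk_part[OF assms(2,1)])
  note AE_D = AE_disk_part[OF assms(2)]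
  show ?thesis
    unfolding \<mu>_def
    by (intro Lt_direct_sum_of_splitting[OF cD cT assms(9) AE_D AE_T]
        splitting_by_separating_polynomials[OF cD cT assms(9) AE_D AE_T] separating)
qed

end
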